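(* Let $(K,\mathcal{L})$ be a $C$-minimal valued field, $W$ a definable set, and $f\colon X\subseteq W\times K\rightarrow K^\times$ a definable family of functions defined at a neighborhood of infinity. Then there is a definable family of functions $h\colon Y\subseteq W\times \Gamma_K\to \Gamma_K$ such that for all $w\in W$, $f_w$ factorizes at infinity over $\Gamma$ through $h_{w}$.
   Context: Valued fields $(K,v)$ are non-trivially valued; $\Gamma_K$ is the value group. Closed balls are $B(a,\gamma)=\{x\in K: v(x-a)\geq\gamma\}$ for $a \in K$, $\gamma\in\Gamma_K\cup\{+\infty\}$; open balls are $B^\circ(a,\gamma)=\{x\in K: v(x-a)>\gamma\}$ for $a\in K$, $\gamma\in\Gamma_K\cup\{-\infty\}$ (so points are closed balls and $K$ is an open ball). A ball is a closed or an open ball. $\mathcal{L}_{div}=(+,-,\cdot,0,1,\mathrm{div})$ is the language of valued fields, with $\mathrm{div}(x,y)$ interpreted as $v(x)\leq v(y)$. Let $K$ be an algebraically closed valued field and $(K,\mathcal{L})$ an expansion of $(K,\mathcal{L}_{div})$ ($\mathcal{L}\supseteq\mathcal{L}_{div}$). $(K,\mathcal{L})$ is $C$-minimal (a "$C$-minimal valued field") if for every structure $(K',\mathcal{L})$ elementarily equivalent to it, every $\mathcal{L}$-definable subset of $K'$ is a boolean combination of balls. "Definable" means $\mathcal{L}$-definable with parameters; for subsets of (products involving) $\Gamma_K$ it means interpretable. A definable family $X\subseteq W\times K$ is a definable set whose projection to $W$ is all of $W$; $X_w=\{x: (w,x)\in X\}$. A definable family of functions is a definable function $f\colon X\subseteq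 W\times K\to K$, with fibers $f_w\colon X_w\to K$, $f_w(x)=f(w,x)$; similarly with $\Gamma_K$ in place of $K$. A neighborhood of infinity is a set of the form $K\setminus B(0,\gamma)$ with $\gamma\in\Gamma_K$. The family $f$ is defined at a neighborhood of infinity if for every $w\in W$ the set $X_w$ contains a neighborhood of infinity (which may depend on $w$). A function $g\colon Z\subseteq K\to K$ defined at a neighborhood of infinity factorizes at infinity over $\Gamma$ through a (possibly partial) function $h\colon\Gamma_K\to\Gamma_K$ if there is $\gamma_0\in\Gamma_K$ such that $v(g(x))=h(v(x))$ for all $x\in Z\setminus B(0,\gamma_0)$. *)

theory Defs
  imports Main "HOL-Library.Extended" "HOL-Computational_Algebra.Polynomial"
begin

section \<open>First-order logic over languages extending the language of valued fields\<close>

datatype 'f vf_fun = Plus | Minus | Times | Zero | One | Extra_Fun 'f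

datatype 'r vf_rel = Div | Extra_Rel 'r

text \<open>A language containing the language of valued fields is given by the sets of its
  additional symbols, so that these sets may be empty, together with their arities.\<close>

record ('f, 'r) vf_language =
  extra_funs :: "'f set"
  extra_rels :: "'r set"
  extra_fun_arity :: "'f \<Rightarrow> nat"
  extra_rel_arity :: "'r \<Rightarrow> nat"

fun fun_in_lang :: "('f, 'r) vf_language \<Rightarrow> 'f vf_fun \<Rightarrow> bool" where
  "fun_in_lang L (Extra_Fun f) \<longleftrightarrow> f \<in> extra_funs L"
| "fun_in_lang L _ \<longleftrightarrow> True"

fun rel_in_lang :: "('f, 'r) vf_language \<Rightarrow> 'r vf_rel \<Rightarrow> bool" where
  "rel_in_lang L (Extra_Rel r) \<longleftrightarrow> r \<in> extra_rels L"
| "rel_in_lang L Div \<longleftrightarrow> True"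

fun fun_arity :: "('f, 'r) vf_language \<Rightarrow> 'f vf_fun \<Rightarrow> nat" where
  "fun_arity L Plus = 2"
| "fun_arity L Minus = 2"
| "fun_arity L Times = 2"
| "fun_arity L Zero = 0"
| "fun_arity L One = 0"
| "fun_arity L (Extra_Fun f) = extra_fun_arity L f"

fun rel_arity :: "('f, 'r) vf_language \<Rightarrow> 'r vf_rel \<Rightarrow> nat" where
  "rel_arity L Div = 2"
| "rel_arity L (Extra_Rel r) = extra_rel_arity L r"

datatype 'f fo_term = Var nat | App "'f vf_fun" "'f fo_term list"

datatype ('f, 'r) fo_form =
    Eq "'f fo_term" "'f fo_term"
  | Rel "'r vf_rel" "'f fo_term list"
  | Neg "('f, 'r) fo_form"
  | Conj "('f, 'r) fo_form" "('f, 'r) fo_form"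
  | Ex nat "('f, 'r) fo_form"

fun term_in_lang :: "('f, 'r) vf_language \<Rightarrow> 'f fo_term \<Rightarrow> bool" where
  "term_in_lang L (Var i) \<longleftrightarrow> True"
| "term_in_lang L (App f ts) \<longleftrightarrow>
     fun_in_lang L f \<and> length ts = fun_arity L f \<and> (\<forall>t\<in>set ts. term_in_lang L t)"

fun form_in_lang :: "('f, 'r) vf_language \<Rightarrow> ('f, 'r) fo_form \<Rightarrow> bool" where
  "form_in_lang L (Eq s t) \<longleftrightarrow> term_in_lang L s \<and> term_in_lang L t"
| "form_in_lang L (Rel r ts) \<longleftrightarrow>
     rel_in_lang L r \<and> length ts = rel_arity L r \<and> (\<forall>t\<in>set ts. term_in_lang L t)"
| "form_in_lang L (Neg \<phi>) \<longleftrightarrow> form_in_lang L \<phi>"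
| "form_in_lang L (Conj \<phi> \<psi>) \<longleftrightarrow> form_in_lang L \<phi> \<and> form_in_lang L \<psi>"
| "form_in_lang L (Ex i \<phi>) \<longleftrightarrow> form_in_lang L \<phi>"

fun term_vars :: "'f fo_term \<Rightarrow> nat set" where
  "term_vars (Var i) = {i}"
| "term_vars (App f ts) = (\<Union>t\<in>set ts. term_vars t)"

fun free_vars :: "('f, 'r) fo_form \<Rightarrow> nat set" where
  "free_vars (Eq s t) = term_vars s \<union> term_vars t"
| "free_vars (Rel r ts) = (\<Union>t\<in>set ts. term_vars t)"
| "free_vars (Neg \<phi>) = free_vars \<phi>"
| "free_vars (Conj \<phi> \<psi>) = free_vars \<phi> \<union> free_vars \<psi>"
| "free_vars (Ex i \<phi>) = free_vars \<phi> - {i}"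

definition sentence :: "('f, 'r) vf_language \<Rightarrow> ('f, 'r) fo_form \<Rightarrow> bool" where
  "sentence L \<phi> \<longleftrightarrow> form_in_lang L \<phi> \<and> free_vars \<phi> = {}"

record ('f, 'r, 'a) fo_struct =
  dom :: "'a set"
  fun_interp :: "'f vf_fun \<Rightarrow> 'a list \<Rightarrow> 'a"
  rel_interp :: "'r vf_rel \<Rightarrow> 'a list \<Rightarrow> bool"

definition is_struct :: "('f, 'r) vf_language \<Rightarrow> ('f, 'r, 'a) fo_struct \<Rightarrow> bool" where
  "is_struct L M \<longleftrightarrow> dom M \<noteq> {} \<and>
     (\<forall>f xs. fun_in_lang L f \<longrightarrow> length xs = fun_arity L f \<longrightarrow> set xs \<subseteq> dom M \<longrightarrow>
        fun_interp M f xs \<in> dom M)"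

fun term_val :: "('f, 'r, 'a) fo_struct \<Rightarrow> (nat \<Rightarrow> 'a) \<Rightarrow> 'f fo_term \<Rightarrow> 'a" where
  "term_val M e (Var i) = e i"
| "term_val M e (App f ts) = fun_interp M f (map (term_val M e) ts)"

fun sat :: "('f, 'r, 'a) fo_struct \<Rightarrow> (nat \<Rightarrow> 'a) \<Rightarrow> ('f, 'r) fo_form \<Rightarrow> bool" where
  "sat M e (Eq s t) \<longleftrightarrow> term_val M e s = term_val M e t"
| "sat M e (Rel r ts) \<longleftrightarrow> rel_interp M r (map (term_val M e) ts)"
| "sat M e (Neg \<phi>) \<longleftrightarrow> \<not> sat M e \<phi>"
| "sat M e (Conj \<phi> \<psi>) \<longleftrightarrow> sat M e \<phi> \<and> sat M e \<psi>"
| "sat M e (Ex i \<phi>) \<longleftrightarrow> (\<exists>a\<in>dom M. sat M (e(i := a)) \<phi>)"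

definition models :: "('f, 'r, 'a) fo_struct \<Rightarrow> ('f, 'r) fo_form \<Rightarrow> bool" where
  "models M \<phi> \<longleftrightarrow> (\<forall>e. range e \<subseteq> dom M \<longrightarrow> sat M e \<phi>)"

definition elem_equiv ::
  "('f, 'r) vf_language \<Rightarrow> ('f, 'r, 'a) fo_struct \<Rightarrow> ('f, 'r, 'b) fo_struct \<Rightarrow> bool" where
  "elem_equiv L M N \<longleftrightarrow> (\<forall>\<phi>. sentence L \<phi> \<longrightarrow> (models M \<phi> \<longleftrightarrow> models N \<phi>))"

text \<open>Definability with parameters of a subset of the \<open>k\<close>-th power of the domain: the variables
  below \<open>k\<close> stand for the coordinates, the environment \<open>e\<close> supplies the parameters.\<close>

definition definable ::
  "('f, 'r) vf_language \<Rightarrow> ('f, 'r, 'a) fo_struct \<Rightarrow> nat \<Rightarrow> 'a list set \<Rightarrow> bool" where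
  "definable L M k D \<longleftrightarrow>
     (\<exists>\<phi> e. form_in_lang L \<phi> \<and> range e \<subseteq> dom M \<and>
        D = {xs. length xs = k \<and> set xs \<subseteq> dom M \<and>
                 sat M (\<lambda>i. if i < k then xs ! i else e i) \<phi>})"


section \<open>Valued fields\<close>

text \<open>The type \<open>'g\<close> is the value group, hence surjectivity; \<open>Pinf\<close> is the valuation of \<open>0\<close>, and
  \<open>Minf\<close> only serves as a radius of open balls. The last condition is non-triviality.\<close>

definition valuation :: "('a::field \<Rightarrow> 'g::linordered_ab_group_add extended) \<Rightarrow> bool" where
  "valuation v \<longleftrightarrow>
     (\<forall>x. v x \<noteq> Minf) \<and>
     (\<forall>x. v x = Pinf \<longleftrightarrow> x = 0) \<and>
     (\<forall>x y. v (x * y) = v x + v y) \<and>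
     (\<forall>x y. min (v x) (v y) \<le> v (x + y)) \<and>
     (\<forall>\<gamma>. \<exists>x. v x = Fin \<gamma>) \<and>
     (\<exists>x. x \<noteq> 0 \<and> v x \<noteq> Fin 0)"

definition closed_ball ::
  "('a::field \<Rightarrow> 'g::linordered_ab_group_add extended) \<Rightarrow> 'a \<Rightarrow> 'g extended \<Rightarrow> 'a set" where
  "closed_ball v a \<gamma> = {x. v (x - a) \<ge> \<gamma>}"

definition open_ball ::
  "('a::field \<Rightarrow> 'g::linordered_ab_group_add extended) \<Rightarrow> 'a \<Rightarrow> 'g extended \<Rightarrow> 'a set" where
  "open_ball v a \<gamma> = {x. v (x - a) > \<gamma>}"

definition expands_valued_field ::
  "('f, 'r, 'a::field) fo_struct \<Rightarrow> ('a \<Rightarrow> 'g::linordered_ab_group_add extended) \<Rightarrow> bool" where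
  "expands_valued_field M v \<longleftrightarrow>
     dom M = UNIV \<and>
     (\<forall>x y. fun_interp M Plus [x, y] = x + y) \<and>
     (\<forall>x y. fun_interp M Minus [x, y] = x - y) \<and>
     (\<forall>x y. fun_interp M Times [x, y] = x * y) \<and>
     fun_interp M Zero [] = 0 \<and>
     fun_interp M One [] = 1 \<and>
     (\<forall>x y. rel_interp M Div [x, y] \<longleftrightarrow> v x \<le> v y)"


section \<open>C-minimality\<close>

text \<open>A structure elementarily equivalent to a valued field carries a valuation, determined up to
  isomorphism by \<open>Div\<close>, which maps the nonzero elements onto the value group. A radius is
  therefore given by an element \<open>c\<close> of that valuation: the three cases are
  \<open>v (x - a) \<ge> v c\<close> (a point if \<open>c = 0\<close>), \<open>v (x - a) > v c\<close> with \<open>c \<noteq> 0\<close>, and the whole field.\<close>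

definition is_ball :: "('f, 'r, 'a) fo_struct \<Rightarrow> 'a set \<Rightarrow> bool" where
  "is_ball M B \<longleftrightarrow>
     (\<exists>a\<in>dom M. \<exists>c\<in>dom M. B = {x \<in> dom M. rel_interp M Div [c, fun_interp M Minus [x, a]]}) \<or>
     (\<exists>a\<in>dom M. \<exists>c\<in>dom M. c \<noteq> fun_interp M Zero [] \<and>
        B = {x \<in> dom M. \<not> rel_interp M Div [fun_interp M Minus [x, a], c]}) \<or>
     B = dom M"

lemma valuation_surj:
  assumes "valuation v" "\<gamma> \<noteq> Minf"
  obtains c where "v c = \<gamma>"
proof (cases \<gamma>)
  case (Fin \<delta>)
  from assms(1) obtain c where "v c = Fin \<delta>" unfolding valuation_def by blast
  with Fin that show ?thesis by simp
next
  case Pinf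
  with assms(1) have "v 0 = \<gamma>" by (simp add: valuation_def)
  with that show ?thesis by simp
qed (use assms(2) in simp)

lemma is_ball_iff:
  fixes M :: "('f, 'r, 'a::field) fo_struct"
    and v :: "'a \<Rightarrow> 'g::linordered_ab_group_add extended"
  assumes v: "valuation v" and M: "expands_valued_field M v"
  shows "is_ball M B \<longleftrightarrow>
    (\<exists>a \<gamma>. \<gamma> \<noteq> Minf \<and> B = closed_ball v a \<gamma>) \<or> (\<exists>a \<gamma>. \<gamma> \<noteq> Pinf \<and> B = open_ball v a \<gamma>)"
    (is "_ \<longleftrightarrow> ?C \<or> ?O")
proof -
  have c: "(\<exists>a c. B = {x. v c \<le> v (x - a)}) \<longleftrightarrow> ?C"
  proof
    assume "\<exists>a c. B = {x. v c \<le> v (x - a)}"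
    then show ?C using v unfolding valuation_def closed_ball_def by metis
  next
    assume ?C
    then obtain a \<gamma> where \<gamma>: "\<gamma> \<noteq> Minf" "B = closed_ball v a \<gamma>" by blast
    moreover obtain c where "v c = \<gamma>" using valuation_surj[OF v \<gamma>(1)] by blast
    ultimately show "\<exists>a c. B = {x. v c \<le> v (x - a)}" unfolding closed_ball_def by blast
  qed
  have o: "(\<exists>a c. c \<noteq> 0 \<and> B = {x. v c < v (x - a)}) \<or> B = UNIV \<longleftrightarrow> ?O"
  proof
    assume "(\<exists>a c. c \<noteq> 0 \<and> B = {x. v c < v (x - a)}) \<or> B = UNIV"
    then show ?O
    proof
      assume "\<exists>a c. c \<noteq> 0 \<and> B = {x. v c < v (x - a)}"
      then show ?O using v unfolding valuation_def open_ball_def by metis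
    next
      assume "B = UNIV"
      moreover have "open_ball v 0 Minf = UNIV"
        using v unfolding valuation_def open_ball_def
        by (auto simp: less_extended_def)
      ultimately show ?O by blast
    qed
  next
    assume ?O
    then obtain a \<gamma> where \<gamma>: "\<gamma> \<noteq> Pinf" "B = open_ball v a \<gamma>" by blast
    show "(\<exists>a c. c \<noteq> 0 \<and> B = {x. v c < v (x - a)}) \<or> B = UNIV"
    proof (cases "\<gamma> = Minf")
      case True
      then have "B = UNIV" using \<gamma>(2) v unfolding valuation_def open_ball_def
        by (auto simp: less_extended_def)
      then show ?thesis ..
    next
      case False
      then obtain c where "v c = \<gamma>" using valuation_surj[OF v] by blast
      moreover from this \<gamma>(1) v have "c \<noteq> 0" unfolding valuation_def by auto
      ultimately show ?thesis using \<gamma>(2) unfolding open_ball_def by blast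
    qed
  qed
  from M have "is_ball M B \<longleftrightarrow> (\<exists>a c. B = {x. v c \<le> v (x - a)}) \<or>
      ((\<exists>a c. c \<noteq> 0 \<and> B = {x. v c < v (x - a)}) \<or> B = UNIV)"
    by (simp add: is_ball_def expands_valued_field_def not_le)
  with c o show ?thesis by simp
qed

inductive ball_combination :: "('f, 'r, 'a) fo_struct \<Rightarrow> 'a set \<Rightarrow> bool" for M where
  ball: "is_ball M B \<Longrightarrow> ball_combination M B"
| compl: "ball_combination M A \<Longrightarrow> ball_combination M (dom M - A)"
| union: "ball_combination M A \<Longrightarrow> ball_combination M B \<Longrightarrow> ball_combination M (A \<union> B)"

text \<open>Quantification over all structures elementarily equivalent to \<open>M\<close> needs a fixed type for
  their domains. By the downward Loewenheim-Skolem theorem nothing is lost once this type has at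
  least as many elements as there are formulas: if \<open>\<phi>\<close> with parameters \<open>b\<close> defines in some \<open>N\<close> a
  set that is not a boolean combination of balls, then it does so in every elementary substructure
  of \<open>N\<close> containing \<open>b\<close>, because being a boolean combination of balls of a given shape is
  first-order expressible. The type below also has room for a copy of \<open>M\<close> itself.\<close>

type_synonym ('f, 'r, 'a) model_univ = "(('f, 'r) fo_form + 'a) set"

definition C_minimal :: "('f, 'r) vf_language \<Rightarrow> ('f, 'r, 'a) fo_struct \<Rightarrow> bool" where
  "C_minimal L M \<longleftrightarrow>
     (\<forall>N :: ('f, 'r, ('f, 'r, 'a) model_univ) fo_struct.
        is_struct L N \<longrightarrow> elem_equiv L M N \<longrightarrow>
        (\<forall>S. S \<subseteq> dom N \<longrightarrow> definable L N 1 ((\<lambda>x. [x]) ` S) \<longrightarrow> ball_combination N S))"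

definition C_minimal_valued_field ::
  "('f, 'r) vf_language \<Rightarrow> ('f, 'r, 'a::alg_closed_field) fo_struct \<Rightarrow>
     ('a \<Rightarrow> 'g::linordered_ab_group_add extended) \<Rightarrow> bool" where
  "C_minimal_valued_field L M v \<longleftrightarrow>
     valuation v \<and> is_struct L M \<and> expands_valued_field M v \<and> C_minimal L M"


section \<open>Definable sets and families involving the value group\<close>

text \<open>A subset of the product of the \<open>n\<close>-th power of the field and the \<open>m\<close>-th power of the value
  group is interpretable iff its preimage under the valuation is definable. For \<open>m = 0\<close> this is
  plain definability.\<close>

definition definable2 ::
  "('f, 'r) vf_language \<Rightarrow> ('f, 'r, 'a::field) fo_struct \<Rightarrow>
     ('a \<Rightarrow> 'g::linordered_ab_group_add extended) \<Rightarrow>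
     nat \<Rightarrow> nat \<Rightarrow> ('a list \<times> 'g list) set \<Rightarrow> bool" where
  "definable2 L M v n m D \<longleftrightarrow>
     (\<forall>(xs, gs) \<in> D. length xs = n \<and> length gs = m) \<and>
     definable L M (n + m) {xs @ ys |xs ys gs. (xs, gs) \<in> D \<and> map v ys = map Fin gs}"

definition definable_field_family ::
  "('f, 'r) vf_language \<Rightarrow> ('f, 'r, 'a::field) fo_struct \<Rightarrow>
     ('a \<Rightarrow> 'g::linordered_ab_group_add extended) \<Rightarrow> nat \<Rightarrow> nat \<Rightarrow>
     ('a list \<times> 'g list) set \<Rightarrow> (('a list \<times> 'g list) \<times> 'a) set \<Rightarrow> bool" where
  "definable_field_family L M v n m W X \<longleftrightarrow>
     fst ` X = W \<and>
     definable2 L M v (Suc n) m {(xs @ [x], gs) |xs gs x. ((xs, gs), x) \<in> X}"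

definition definable_group_family ::
  "('f, 'r) vf_language \<Rightarrow> ('f, 'r, 'a::field) fo_struct \<Rightarrow>
     ('a \<Rightarrow> 'g::linordered_ab_group_add extended) \<Rightarrow> nat \<Rightarrow> nat \<Rightarrow>
     ('a list \<times> 'g list) set \<Rightarrow> (('a list \<times> 'g list) \<times> 'g) set \<Rightarrow> bool" where
  "definable_group_family L M v n m W Y \<longleftrightarrow>
     fst ` Y = W \<and>
     definable2 L M v n (Suc m) {(xs, gs @ [\<gamma>]) |xs gs \<gamma>. ((xs, gs), \<gamma>) \<in> Y}"

text \<open>A family of functions on \<open>X\<close> is a total function of which only the values on \<open>X\<close> matter;
  its definability is that of its graph.\<close>

definition definable_field_fun_family ::
  "('f, 'r) vf_language \<Rightarrow> ('f, 'r, 'a::field) fo_struct \<Rightarrow>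
     ('a \<Rightarrow> 'g::linordered_ab_group_add extended) \<Rightarrow> nat \<Rightarrow> nat \<Rightarrow>
     ('a list \<times> 'g list) set \<Rightarrow> (('a list \<times> 'g list) \<times> 'a) set \<Rightarrow>
     ('a list \<times> 'g list \<Rightarrow> 'a \<Rightarrow> 'a) \<Rightarrow> bool" where
  "definable_field_fun_family L M v n m W X f \<longleftrightarrow>
     definable_field_family L M v n m W X \<and>
     definable2 L M v (Suc (Suc n)) m
       {(xs @ [x, f (xs, gs) x], gs) |xs gs x. ((xs, gs), x) \<in> X}"

definition definable_group_fun_family ::
  "('f, 'r) vf_language \<Rightarrow> ('f, 'r, 'a::field) fo_struct \<Rightarrow>
     ('a \<Rightarrow> 'g::linordered_ab_group_add extended) \<Rightarrow> nat \<Rightarrow> nat \<Rightarrow>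
     ('a list \<times> 'g list) set \<Rightarrow> (('a list \<times> 'g list) \<times> 'g) set \<Rightarrow>
     ('a list \<times> 'g list \<Rightarrow> 'g \<Rightarrow> 'g) \<Rightarrow> bool" where
  "definable_group_fun_family L M v n m W Y h \<longleftrightarrow>
     definable_group_family L M v n m W Y \<and>
     definable2 L M v n (Suc (Suc m))
       {(xs, gs @ [\<gamma>, h (xs, gs) \<gamma>]) |xs gs \<gamma>. ((xs, gs), \<gamma>) \<in> Y}"


section \<open>Behaviour at infinity\<close>

definition nbhd_infinity ::
  "('a::field \<Rightarrow> 'g::linordered_ab_group_add extended) \<Rightarrow> 'a set \<Rightarrow> bool" where
  "nbhd_infinity v U \<longleftrightarrow> (\<exists>\<gamma>. U = - closed_ball v 0 (Fin \<gamma>))"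

definition family_defined_near_infinity ::
  "('a::field \<Rightarrow> 'g::linordered_ab_group_add extended) \<Rightarrow> 'w set \<Rightarrow> ('w \<times> 'a) set \<Rightarrow> bool" where
  "family_defined_near_infinity v W X \<longleftrightarrow>
     (\<forall>w\<in>W. \<exists>U. nbhd_infinity v U \<and> U \<subseteq> X `` {w})"

text \<open>The function \<open>g\<close> on \<open>Z\<close> factorizes at infinity over the value group through the partial
  function \<open>h\<close> with domain \<open>D\<close>; in particular, \<open>h\<close> must be defined where it is used.\<close>

definition factorizes_at_infinity ::
  "('a::field \<Rightarrow> 'g::linordered_ab_group_add extended) \<Rightarrow> 'a set \<Rightarrow> ('a \<Rightarrow> 'a) \<Rightarrow>
     'g set \<Rightarrow> ('g \<Rightarrow> 'g) \<Rightarrow> bool" where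
  "factorizes_at_infinity v Z g D h \<longleftrightarrow>
     (\<exists>\<gamma>\<^sub>0. \<forall>x \<in> Z - closed_ball v 0 (Fin \<gamma>\<^sub>0).
        \<exists>\<gamma>\<in>D. v x = Fin \<gamma> \<and> v (g x) = Fin (h \<gamma>))"

end

theory Submission
  imports Defs
begin

text \<open>
  For a single function \<open>g\<close>, compare the values at \<open>x\<close> and \<open>u x\<close> for \<open>x\<close> tending to infinity. By
  C-minimality, for each \<open>u\<close> one of \<open>v (g (u x)) < v (g x)\<close>, \<open>=\<close>, \<open>>\<close> holds eventually, so the
  \<open>u\<close> with eventually \<open>v (g (u x)) > v (g x)\<close> form the positive cone of an order on a quotient of
  the multiplicative group. The units in this cone meet finitely or cofinitely many residue
  classes; the latter contradicts disjointness from the inverse cone, and the former contradicts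
  closure under roots, unless there are none. Hence \<open>v (g (u x)) = v (g x)\<close> eventually for each
  unit \<open>u\<close>.

  The units for which this equality holds whenever \<open>v x < v c\<close> form a chain of definable subgroups
  with union all the units, and uniformity in \<open>u\<close> means that some member of the chain is
  everything. Otherwise all of them are finite modulo residue classes. Rank the residue classes by
  the chain, and for \<open>n\<close> prime to the residue characteristic consider the classes with an \<open>n\<close>-th
  root of no higher rank. If these are cofinitely many, a finite member of the chain is closed
  under \<open>n\<close>-th roots, which is impossible since it contains nontrivial \<open>n\<close>-th roots of unity. If
  they are finitely many for two coprime exponents \<open>m\<close> and \<open>n\<close>, then for some \<open>x\<close> both \<open>x ^ m\<close>
  and \<open>x ^ n\<close> have lower rank than \<open>x\<close>, contradicting Bezout. This replaces the compactness
  argument, so that C-minimality is only applied to (a copy of) the structure itself.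

  The bound at infinity need not be definable in the family parameter: \<open>h w \<gamma>\<close> is the common value
  of \<open>v (f w x)\<close> on \<open>v x = \<gamma>\<close>, wherever there is one.
\<close>

section \<open>A calculus of definable predicates\<close>

fun rename_term :: "(nat \<Rightarrow> nat) \<Rightarrow> 'f fo_term \<Rightarrow> 'f fo_term" where
  "rename_term \<rho> (Var i) = Var (\<rho> i)"
| "rename_term \<rho> (App f ts) = App f (map (rename_term \<rho>) ts)"

lemma term_in_lang_rename [simp]: "term_in_lang L (rename_term \<rho> t) \<longleftrightarrow> term_in_lang L t"
  by (induction t) auto

lemma term_val_rename: "term_val M e (rename_term \<rho> t) = term_val M (\<lambda>i. e (\<rho> i)) t"
  by (induction t) (auto simp: comp_def cong: map_cong)

lemma term_val_cong:
  "(\<And>i. i \<in> term_vars t \<Longrightarrow> e i = e' i) \<Longrightarrow> term_val M e t = term_val M e' t"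
proof (induction t)
  case (App f ts)
  then have "map (term_val M e) ts = map (term_val M e') ts"
    by (intro map_cong) auto
  then show ?case by (simp only: term_val.simps)
qed simp

lemma sat_cong:
  "(\<And>i. i \<in> free_vars \<phi> \<Longrightarrow> e i = e' i) \<Longrightarrow> sat M e \<phi> \<longleftrightarrow> sat M e' \<phi>"
proof (induction \<phi> arbitrary: e e')
  case (Eq s t)
  have "term_val M e s = term_val M e' s" "term_val M e t = term_val M e' t"
    by (rule term_val_cong, rule Eq, simp)+
  then show ?case by simp
next
  case (Rel r ts)
  have "map (term_val M e) ts = map (term_val M e') ts"
    by (rule map_cong[OF refl], rule term_val_cong, rule Rel) auto
  then show ?case by (simp only: sat.simps)
next
  case (Neg \<phi>)
  have "sat M e \<phi> = sat M e' \<phi>"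
    by (rule Neg.IH, rule Neg.prems) simp
  then show ?case by simp
next
  case (Conj \<phi> \<psi>)
  have "sat M e \<phi> = sat M e' \<phi>" "sat M e \<psi> = sat M e' \<psi>"
    by (rule Conj.IH, rule Conj.prems, simp)+
  then show ?case by simp
next
  case (Ex i \<phi>)
  have "sat M (e(i := a)) \<phi> = sat M (e'(i := a)) \<phi>" for a
    by (rule Ex.IH) (simp add: Ex.prems)
  then show ?case by (simp only: sat.simps)
qed

lemma finite_term_vars: "finite (term_vars t)"
  by (induction t) auto

lemma finite_free_vars: "finite (free_vars \<phi>)"
  by (induction \<phi>) (auto simp: finite_term_vars)

text \<open>Renaming under a quantifier could capture, so the bound variable moves to a fresh
  \<open>j\<close> and the induction runs over all renamings. Stating mere existence avoids fixing a
  choice of fresh variables.\<close>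

lemma rename_form_ex:
  "form_in_lang L \<phi> \<Longrightarrow> \<exists>\<psi>. form_in_lang L \<psi> \<and> (\<forall>e. sat M e \<psi> \<longleftrightarrow> sat M (\<lambda>i. e (\<rho> i)) \<phi>)"
proof (induction \<phi> arbitrary: \<rho>)
  case (Eq s t)
  then show ?case
    by (intro exI[of _ "Eq (rename_term \<rho> s) (rename_term \<rho> t)"]) (auto simp: term_val_rename)
next
  case (Rel r ts)
  then show ?case
    by (intro exI[of _ "Rel r (map (rename_term \<rho>) ts)"])
      (auto simp: term_val_rename comp_def)
next
  case (Neg \<phi>)
  then obtain \<psi> where "form_in_lang L \<psi>" "\<forall>e. sat M e \<psi> \<longleftrightarrow> sat M (\<lambda>i. e (\<rho> i)) \<phi>"
    by (metis form_in_lang.simps(3))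
  then show ?case by (intro exI[of _ "Neg \<psi>"]) auto
next
  case (Conj \<phi>1 \<phi>2)
  then obtain \<psi>1 \<psi>2 where "form_in_lang L \<psi>1" "\<forall>e. sat M e \<psi>1 \<longleftrightarrow> sat M (\<lambda>i. e (\<rho> i)) \<phi>1"
    "form_in_lang L \<psi>2" "\<forall>e. sat M e \<psi>2 \<longleftrightarrow> sat M (\<lambda>i. e (\<rho> i)) \<phi>2"
    by (metis form_in_lang.simps(4))
  then show ?case by (intro exI[of _ "Conj \<psi>1 \<psi>2"]) auto
next
  case (Ex i \<phi>)
  obtain j where j: "j \<notin> \<rho> ` free_vars \<phi>"
    using ex_new_if_finite[OF infinite_UNIV_nat] finite_free_vars by blast
  obtain \<psi> where \<psi>: "form_in_lang L \<psi>"
    "\<And>e. sat M e \<psi> \<longleftrightarrow> sat M (\<lambda>k. e ((\<rho>(i := j)) k)) \<phi>"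
    using Ex.IH[of "\<rho>(i := j)"] Ex.prems by auto
  have "sat M (e(j := a)) \<psi> \<longleftrightarrow> sat M ((\<lambda>k. e (\<rho> k))(i := a)) \<phi>" for e a
    unfolding \<psi>(2) using j by (intro sat_cong) auto
  then show ?case using \<psi>(1) by (intro exI[of _ "Ex j \<psi>"]) auto
qed

text \<open>Every variable of a formula is assigned either an entry of the environment or a parameter.\<close>

definition assign :: "(nat \<Rightarrow> nat + 'a) \<Rightarrow> (nat \<Rightarrow> 'a) \<Rightarrow> nat \<Rightarrow> 'a" where
  "assign s e i = (case s i of Inl j \<Rightarrow> e j | Inr c \<Rightarrow> c)"

text \<open>Definability is recorded semantically, as a property of a function of the environment,
  so that it can be derived by introduction rules without writing formulas.\<close>

definition dterm ::
  "('f, 'r) vf_language \<Rightarrow> ('f, 'r, 'a) fo_struct \<Rightarrow> ((nat \<Rightarrow> 'a) \<Rightarrow> 'a) \<Rightarrow> bool" where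
  "dterm L M t \<longleftrightarrow> (\<exists>\<tau> s. term_in_lang L \<tau> \<and> (\<forall>e. t e = term_val M (assign s e) \<tau>))"

definition dform ::
  "('f, 'r) vf_language \<Rightarrow> ('f, 'r, 'a) fo_struct \<Rightarrow> ((nat \<Rightarrow> 'a) \<Rightarrow> bool) \<Rightarrow> bool" where
  "dform L M P \<longleftrightarrow> (\<exists>\<phi> s. form_in_lang L \<phi> \<and> (\<forall>e. P e \<longleftrightarrow> sat M (assign s e) \<phi>))"

text \<open>Interleaves two parameter assignments on the even and the odd variables, so that two
  formulas renamed apart share one assignment.\<close>

definition merge :: "(nat \<Rightarrow> 'b) \<Rightarrow> (nat \<Rightarrow> 'b) \<Rightarrow> nat \<Rightarrow> 'b" where
  "merge s s' i = (if even i then s (i div 2) else s' (i div 2))"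

lemma assign_merge [simp]:
  "(\<lambda>i. assign (merge s s') e (2 * i)) = assign s e"
  "(\<lambda>i. assign (merge s s') e (Suc (2 * i))) = assign s' e"
  by (auto simp: assign_def merge_def fun_eq_iff)

lemma dterm_pair:
  assumes "dterm L M t" "dterm L M u"
  obtains \<tau> \<upsilon> s where "term_in_lang L \<tau>" "term_in_lang L \<upsilon>"
    "\<And>e. t e = term_val M (assign s e) \<tau>" "\<And>e. u e = term_val M (assign s e) \<upsilon>"
proof -
  obtain \<tau> s where t: "term_in_lang L \<tau>" "\<And>e. t e = term_val M (assign s e) \<tau>"
    using assms(1) by (auto simp: dterm_def)
  obtain \<upsilon> s' where u: "term_in_lang L \<upsilon>" "\<And>e. u e = term_val M (assign s' e) \<upsilon>"
    using assms(2) by (auto simp: dterm_def)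
  show ?thesis
    by (rule that[of "rename_term (\<lambda>i. 2 * i) \<tau>" "rename_term (\<lambda>i. Suc (2 * i)) \<upsilon>" "merge s s'"])
      (use t u in \<open>simp_all add: term_val_rename\<close>)
qed

lemma dform_pair:
  assumes "dform L M P" "dform L M Q"
  obtains \<phi> \<psi> s where "form_in_lang L \<phi>" "form_in_lang L \<psi>"
    "\<And>e. P e \<longleftrightarrow> sat M (assign s e) \<phi>" "\<And>e. Q e \<longleftrightarrow> sat M (assign s e) \<psi>"
proof -
  obtain \<phi> s where P: "form_in_lang L \<phi>" "\<And>e. P e \<longleftrightarrow> sat M (assign s e) \<phi>"
    using assms(1) by (auto simp: dform_def)
  obtain \<psi> s' where Q: "form_in_lang L \<psi>" "\<And>e. Q e \<longleftrightarrow> sat M (assign s' e) \<psi>"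
    using assms(2) by (auto simp: dform_def)
  obtain \<phi>' where \<phi>': "form_in_lang L \<phi>'" "\<And>e. sat M e \<phi>' \<longleftrightarrow> sat M (\<lambda>i. e (2 * i)) \<phi>"
    using rename_form_ex[OF P(1), of M "\<lambda>i. 2 * i"] by blast
  obtain \<psi>' where \<psi>': "form_in_lang L \<psi>'" "\<And>e. sat M e \<psi>' \<longleftrightarrow> sat M (\<lambda>i. e (Suc (2 * i))) \<psi>"
    using rename_form_ex[OF Q(1), of M "\<lambda>i. Suc (2 * i)"] by blast
  show ?thesis
    by (rule that[of \<phi>' \<psi>' "merge s s'"]) (use \<phi>' \<psi>' P Q in simp_all)
qed

lemma dterm_var: "dterm L M (\<lambda>e. e i)"
  unfolding dterm_def by (intro exI[of _ "Var i"] exI[of _ Inl]) (simp add: assign_def)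

lemma dterm_const: "dterm L M (\<lambda>e. c)"
  unfolding dterm_def by (intro exI[of _ "Var 0"] exI[of _ "\<lambda>_. Inr c"]) (simp add: assign_def)

lemma dform_Not: "dform L M P \<Longrightarrow> dform L M (\<lambda>e. \<not> P e)"
  unfolding dform_def by (metis form_in_lang.simps(3) sat.simps(3))

lemma dform_conj:
  assumes "dform L M P" "dform L M Q"
  shows "dform L M (\<lambda>e. P e \<and> Q e)"
proof -
  obtain \<phi> \<psi> s where "form_in_lang L \<phi>" "form_in_lang L \<psi>"
    "\<And>e. P e \<longleftrightarrow> sat M (assign s e) \<phi>" "\<And>e. Q e \<longleftrightarrow> sat M (assign s e) \<psi>"
    by (rule dform_pair[OF assms]) (use that in blast)
  then show ?thesis unfolding dform_def
    by (intro exI[of _ "Conj \<phi> \<psi>"] exI[of _ s]) simp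
qed

lemma dform_imp:
  assumes "dform L M P" "dform L M Q"
  shows "dform L M (\<lambda>e. P e \<longrightarrow> Q e)"
  using dform_Not[OF dform_conj[OF assms(1) dform_Not[OF assms(2)]]] by simp

lemma dform_eq:
  assumes "dterm L M t" "dterm L M u"
  shows "dform L M (\<lambda>e. t e = u e)"
proof -
  obtain \<tau> \<upsilon> s where "term_in_lang L \<tau>" "term_in_lang L \<upsilon>"
    "\<And>e. t e = term_val M (assign s e) \<tau>" "\<And>e. u e = term_val M (assign s e) \<upsilon>"
    by (rule dterm_pair[OF assms]) (use that in blast)
  then show ?thesis unfolding dform_def
    by (intro exI[of _ "Eq \<tau> \<upsilon>"] exI[of _ s]) simp
qed

lemma dform_subst:
  assumes "dform L M P"
  shows "dform L M (\<lambda>e. P (assign s e))"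
proof -
  obtain \<phi> s' where P: "form_in_lang L \<phi>" "\<And>e. P e \<longleftrightarrow> sat M (assign s' e) \<phi>"
    using assms by (auto simp: dform_def)
  have "assign s' (assign s e) =
      assign (\<lambda>i. case s' i of Inl j \<Rightarrow> s j | Inr c \<Rightarrow> Inr c) e" for e
    by (auto simp: assign_def fun_eq_iff split: sum.split)
  then show ?thesis unfolding dform_def using P by (metis (no_types, lifting))
qed

text \<open>In the premise the bound variable is the entry \<open>0\<close> of the environment.\<close>

lemma dform_Ex:
  assumes "dform L M (\<lambda>e. P (\<lambda>i. e (Suc i)) (e 0))" and dom: "dom M = UNIV"
  shows "dform L M (\<lambda>e. \<exists>a. P e a)"
proof -
  obtain \<phi> s where P: "form_in_lang L \<phi>"
    "\<And>e. P (\<lambda>i. e (Suc i)) (e 0) \<longleftrightarrow> sat M (assign s e) \<phi>"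
    using assms by (auto simp: dform_def)
  \<comment> \<open>Several variables may read entry \<open>0\<close>; all of them are merged into
    variable \<open>0\<close>, which is then quantified. The others move up by one, and
    \<open>j - 1\<close> undoes the shift of the environment.\<close>
  define \<rho> where "\<rho> i = (if s i = Inl 0 then 0 else Suc i)" for i
  define s' where "s' i = (case i of 0 \<Rightarrow> Inl 0
    | Suc i \<Rightarrow> (case s i of Inl j \<Rightarrow> Inl (j - 1) | Inr c \<Rightarrow> Inr c))" for i
  obtain \<psi> where \<psi>: "form_in_lang L \<psi>" "\<And>e. sat M e \<psi> \<longleftrightarrow> sat M (\<lambda>i. e (\<rho> i)) \<phi>"
    using rename_form_ex[OF P(1), of M \<rho>] by blast
  have "P e a \<longleftrightarrow> sat M ((assign s' e)(0 := a)) \<psi>" for e a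
  proof -
    have "(\<lambda>i. ((assign s' e)(0 := a)) (\<rho> i)) = assign s (case_nat a e)"
      by (auto simp: fun_eq_iff assign_def \<rho>_def s'_def split: sum.split nat.split)
    then show ?thesis unfolding \<psi>(2) using P(2)[of "case_nat a e"] by simp
  qed
  then have "P e = (\<lambda>a. sat M ((assign s' e)(0 := a)) \<psi>)" for e
    by (intro ext)
  then show ?thesis unfolding dform_def
    by (intro exI[of _ "Ex 0 \<psi>"] exI[of _ s']) (simp add: \<psi>(1) dom del: fun_upd_apply)
qed

lemma dform_All:
  assumes "dform L M (\<lambda>e. P (\<lambda>i. e (Suc i)) (e 0))" and dom: "dom M = UNIV"
  shows "dform L M (\<lambda>e. \<forall>a. P e a)"
  using dform_Not[OF dform_Ex[OF dform_Not[OF assms(1)] dom]] by simp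

lemma definable_iff_dform:
  assumes dom: "dom M = UNIV"
  shows "definable L M k A \<longleftrightarrow> (\<forall>xs\<in>A. length xs = k) \<and> dform L M (\<lambda>e. map e [0..<k] \<in> A)"
proof
  assume "definable L M k A"
  then obtain \<phi> e0 where \<phi>: "form_in_lang L \<phi>"
    "A = {xs. length xs = k \<and> sat M (\<lambda>i. if i < k then xs ! i else e0 i) \<phi>}"
    by (auto simp: definable_def dom)
  have "map e [0..<k] \<in> A \<longleftrightarrow> sat M (assign (\<lambda>i. if i < k then Inl i else Inr (e0 i)) e) \<phi>" for e
  proof -
    have "(\<lambda>i. if i < k then map e [0..<k] ! i else e0 i) =
        assign (\<lambda>i. if i < k then Inl i else Inr (e0 i)) e"
      by (auto simp: assign_def)
    then show ?thesis using \<phi>(2) by simp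
  qed
  then show "(\<forall>xs\<in>A. length xs = k) \<and> dform L M (\<lambda>e. map e [0..<k] \<in> A)"
    using \<phi> unfolding dform_def by blast
next
  assume A: "(\<forall>xs\<in>A. length xs = k) \<and> dform L M (\<lambda>e. map e [0..<k] \<in> A)"
  then obtain \<phi> s where \<phi>: "form_in_lang L \<phi>"
    "\<And>e. map e [0..<k] \<in> A \<longleftrightarrow> sat M (assign s e) \<phi>"
    by (auto simp: dform_def)
  \<comment> \<open>Membership depends only on the first \<open>k\<close> entries, so a variable
    reading a later entry may take the value \<open>undefined\<close>, stored like a parameter at
    position \<open>k + i\<close>.\<close>
  define \<rho> where "\<rho> i = (case s i of Inl j \<Rightarrow> if j < k then j else k + i | Inr c \<Rightarrow> k + i)" for i
  define e0 where "e0 i = (case s (i - k) of Inl j \<Rightarrow> undefined | Inr c \<Rightarrow> c)" for i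
  obtain \<psi> where \<psi>: "form_in_lang L \<psi>" "\<And>e. sat M e \<psi> \<longleftrightarrow> sat M (\<lambda>i. e (\<rho> i)) \<phi>"
    using rename_form_ex[OF \<phi>(1), of M \<rho>] by blast
  have "xs \<in> A \<longleftrightarrow> sat M (\<lambda>i. if i < k then xs ! i else e0 i) \<psi>" if "length xs = k" for xs
  proof -
    define e where "e i = (if i < k then xs ! i else undefined)" for i
    have "map e [0..<k] = xs" using that by (auto simp: e_def list_eq_iff_nth_eq)
    moreover have "(\<lambda>i. if \<rho> i < k then xs ! \<rho> i else e0 (\<rho> i)) = assign s e"
      by (auto simp: fun_eq_iff assign_def e_def \<rho>_def e0_def split: sum.split)
    ultimately show ?thesis unfolding \<psi>(2) using \<phi>(2)[of e] by simp
  qed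
  then have "A = {xs. length xs = k \<and> sat M (\<lambda>i. if i < k then xs ! i else e0 i) \<psi>}"
    using A by auto
  then show "definable L M k A" unfolding definable_def dom using \<psi>(1)
    by (intro exI[of _ \<psi>] exI[of _ e0]) auto
qed

lemma dterm_shift:
  assumes "dterm L M t"
  shows "dterm L M (\<lambda>e. t (\<lambda>i. e (Suc i)))"
proof -
  obtain \<tau> s where t: "term_in_lang L \<tau>" "\<And>e. t e = term_val M (assign s e) \<tau>"
    using assms by (auto simp: dterm_def)
  have "assign s (\<lambda>i. e (Suc i)) = assign (\<lambda>i. map_sum Suc id (s i)) e" for e
    by (auto simp: assign_def fun_eq_iff split: sum.split)
  then show ?thesis unfolding dterm_def t(2) using t(1) by auto
qed

text \<open>A term is substituted semantically, through a quantified variable equal to it.\<close>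

lemma dform_let:
  assumes "dform L M (\<lambda>e. R (\<lambda>i. e (Suc i)) (e 0))" "dterm L M t" "dom M = UNIV"
  shows "dform L M (\<lambda>e. R e (t e))"
proof -
  have "dform L M (\<lambda>e. \<exists>a. a = t e \<and> R e a)"
    by (intro dform_Ex dform_conj dform_eq dterm_var dterm_shift assms)
  then show ?thesis by simp
qed

text \<open>Two successive substitutions, the first after exchanging the entries \<open>0\<close>
  and \<open>1\<close>. This turns a definable relation into an introduction rule for arbitrary
  terms.\<close>

lemma dform_rel2:
  assumes R: "dform L M (\<lambda>e. R (e 0) (e 1))" and t: "dterm L M t" and u: "dterm L M u"
    and dom: "dom M = UNIV"
  shows "dform L M (\<lambda>e. R (t e) (u e))"
proof -
  have "dform L M (\<lambda>e. R (e 1) (e 0))"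
    using dform_subst[OF R, of "\<lambda>i. Inl (1 - i)"] by (simp add: assign_def)
  then have "dform L M (\<lambda>e. R (e 0) (u (\<lambda>i. e (Suc i))))"
    by (intro dform_let[where R = "\<lambda>e b. R (e 0) b"] dterm_shift u dom) simp
  then show ?thesis
    by (intro dform_let[where R = "\<lambda>e a. R a (u e)"] t dom)
qed

lemma dterm_binop:
  assumes "dterm L M t" "dterm L M u" "fun_in_lang L f" "fun_arity L f = 2"
  shows "dterm L M (\<lambda>e. fun_interp M f [t e, u e])"
proof -
  obtain \<tau> \<upsilon> s where "term_in_lang L \<tau>" "term_in_lang L \<upsilon>"
    "\<And>e. t e = term_val M (assign s e) \<tau>" "\<And>e. u e = term_val M (assign s e) \<upsilon>"
    by (rule dterm_pair[OF assms(1,2)]) (use that in blast)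
  then show ?thesis unfolding dterm_def
    by (intro exI[of _ "App f [\<tau>, \<upsilon>]"] exI[of _ s]) (simp add: assms)
qed

lemma dform_binrel:
  assumes "dterm L M t" "dterm L M u" "rel_in_lang L r" "rel_arity L r = 2"
  shows "dform L M (\<lambda>e. rel_interp M r [t e, u e])"
proof -
  obtain \<tau> \<upsilon> s where "term_in_lang L \<tau>" "term_in_lang L \<upsilon>"
    "\<And>e. t e = term_val M (assign s e) \<tau>" "\<And>e. u e = term_val M (assign s e) \<upsilon>"
    by (rule dterm_pair[OF assms(1,2)]) (use that in blast)
  then show ?thesis unfolding dform_def
    by (intro exI[of _ "Rel r [\<tau>, \<upsilon>]"] exI[of _ s]) (simp add: assms)
qed

section \<open>Terms and atomic formulas of valued fields\<close>

lemma dterm_arith: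
  assumes "expands_valued_field M v" "dterm L M t" "dterm L M u"
  shows "dterm L M (\<lambda>e. t e + u e)" "dterm L M (\<lambda>e. t e - u e)" "dterm L M (\<lambda>e. t e * u e)"
  using dterm_binop[OF assms(2,3), of Plus] dterm_binop[OF assms(2,3), of Minus]
    dterm_binop[OF assms(2,3), of Times] assms(1)
  by (simp_all add: expands_valued_field_def)

lemma dterm_power:
  assumes "expands_valued_field M v" "dterm L M t"
  shows "dterm L M (\<lambda>e. t e ^ n)"
  by (induction n) (simp_all add: dterm_const dterm_arith(3)[OF assms])

lemma dform_le:
  assumes "expands_valued_field M v" "dterm L M t" "dterm L M u"
  shows "dform L M (\<lambda>e. v (t e) \<le> v (u e))"
  using dform_binrel[OF assms(2,3), of Div] assms(1) by (simp add: expands_valued_field_def)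

lemma dform_less:
  assumes "expands_valued_field M v" "dterm L M t" "dterm L M u"
  shows "dform L M (\<lambda>e. v (t e) < v (u e))"
  using dform_Not[OF dform_le[OF assms(1,3,2)]] by (simp add: not_le)

lemma dform_val_eq:
  assumes "expands_valued_field M v" "dterm L M t" "dterm L M u"
  shows "dform L M (\<lambda>e. v (t e) = v (u e))"
  unfolding order.eq_iff by (intro dform_conj dform_le assms)


section \<open>C-minimality of the structure itself\<close>

lemma sat_copy:
  fixes M :: "('f, 'r, 'a) fo_struct" and \<iota> :: "'a \<Rightarrow> 'b" and N :: "('f, 'r, 'b) fo_struct"
  assumes "inj \<iota>" and "dom M = UNIV" and N: "N = \<lparr>dom = range \<iota>,
      fun_interp = \<lambda>f xs. \<iota> (fun_interp M f (map (inv \<iota>) xs)),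
      rel_interp = \<lambda>r xs. rel_interp M r (map (inv \<iota>) xs)\<rparr>"
  shows "sat N (\<lambda>i. \<iota> (e i)) \<phi> \<longleftrightarrow> sat M e \<phi>"
proof -
  have dom_N: "dom N = range \<iota>"
    and fun_N: "fun_interp N f xs = \<iota> (fun_interp M f (map (inv \<iota>) xs))"
    and rel_N: "rel_interp N r xs = rel_interp M r (map (inv \<iota>) xs)" for f r xs
    by (simp_all add: N)
  have inv: "inv \<iota> (\<iota> x) = x" for x
    using assms(1) by (simp add: inv_f_f)
  have tv: "term_val N (\<lambda>i. \<iota> (e i)) t = \<iota> (term_val M e t)" for t e
  proof (induction t)
    case (App f ts)
    then have "map (inv \<iota>) (map (term_val N (\<lambda>i. \<iota> (e i))) ts) = map (term_val M e) ts"
      by (simp add: inv)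
    then show ?case by (simp only: term_val.simps fun_N)
  qed simp
  show ?thesis
  proof (induction \<phi> arbitrary: e)
    case (Eq s t)
    then show ?case using assms(1) by (simp add: tv inj_eq)
  next
    case (Rel r ts)
    have "map (inv \<iota>) (map (term_val N (\<lambda>i. \<iota> (e i))) ts) = map (term_val M e) ts"
      by (simp add: inv tv)
    then show ?case by (simp only: sat.simps rel_N)
  next
    case (Ex i \<phi>)
    have "(\<lambda>k. \<iota> (e k))(i := \<iota> a) = (\<lambda>k. \<iota> ((e(i := a)) k))" for a
      by auto
    then have "sat N (\<lambda>k. \<iota> (e k)) (Ex i \<phi>) \<longleftrightarrow> (\<exists>a. sat N (\<lambda>k. \<iota> ((e(i := a)) k)) \<phi>)"
      by (simp add: dom_N del: fun_upd_apply)
    then show ?case using Ex by (simp add: assms(2) fun_upd_def)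
  qed auto
qed

text \<open>\<open>C_minimal\<close> speaks only of structures over \<open>model_univ\<close>. The
  structure is therefore copied onto the singletons \<open>{Inr x}\<close>, and the combination of
  balls found there is pulled back.\<close>

lemma C_minimal_ball_combination:
  fixes M :: "('f, 'r, 'a) fo_struct"
  assumes M: "C_minimal L M" "dom M = UNIV" and S: "dform L M (\<lambda>e. e 0 \<in> S)"
  shows "ball_combination M S"
proof -
  define \<iota> :: "'a \<Rightarrow> ('f, 'r, 'a) model_univ" where "\<iota> x = {Inr x}" for x
  have inj: "inj \<iota>" by (auto simp: inj_def \<iota>_def)
  define N where N: "N = \<lparr>dom = range \<iota>,
      fun_interp = \<lambda>f xs. \<iota> (fun_interp M f (map (inv \<iota>) xs)),
      rel_interp = \<lambda>r xs. rel_interp M r (map (inv \<iota>) xs)\<rparr>"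
  have dom_N: "dom N = range \<iota>"
    and fun_N: "fun_interp N f xs = \<iota> (fun_interp M f (map (inv \<iota>) xs))"
    and rel_N: "rel_interp N r xs = rel_interp M r (map (inv \<iota>) xs)" for f r xs
    by (simp_all add: N)
  note sat_N = sat_copy[OF inj M(2) N]
  have inv [simp]: "inv \<iota> (\<iota> x) = x" for x
    using inj by (simp add: inv_f_f)
  have "is_struct L N"
    by (simp add: is_struct_def dom_N fun_N)
  moreover have "elem_equiv L M N"
    unfolding elem_equiv_def models_def
  proof (intro allI impI iffI)
    fix \<phi> :: "('f, 'r) fo_form" and e :: "nat \<Rightarrow> ('f, 'r, 'a) model_univ" assume \<phi>: "\<forall>e. range e \<subseteq> dom M \<longrightarrow> sat M e \<phi>" and e: "range e \<subseteq> dom N"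
    have "(\<lambda>i. \<iota> (inv \<iota> (e i))) = e"
      using e by (auto simp: dom_N fun_eq_iff intro!: f_inv_into_f)
    then show "sat N e \<phi>"
      using sat_N[of "\<lambda>i. inv \<iota> (e i)" \<phi>] \<phi> M(2) by simp
  next
    fix \<phi> :: "('f, 'r) fo_form" and e :: "nat \<Rightarrow> 'a" assume "\<forall>e. range e \<subseteq> dom N \<longrightarrow> sat N e \<phi>"
    moreover have "range (\<lambda>i. \<iota> (e i)) \<subseteq> dom N" by (auto simp: dom_N)
    ultimately have "sat N (\<lambda>i. \<iota> (e i)) \<phi>" by blast
    then show "sat M e \<phi>" by (simp add: sat_N)
  qed
  moreover have "definable L N 1 ((\<lambda>x. [x]) ` (\<iota> ` S))"
  proof -
    have "definable L M 1 ((\<lambda>x. [x]) ` S)"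
      unfolding definable_iff_dform[OF M(2)] using S by (auto simp: image_iff)
    then obtain \<phi> e where \<phi>: "form_in_lang L \<phi>"
      "(\<lambda>x. [x]) ` S = {xs. length xs = 1 \<and> sat M (\<lambda>i. if i < 1 then xs ! i else e i) \<phi>}"
      by (auto simp: definable_def M(2))
    have *: "x \<in> S \<longleftrightarrow> sat M (\<lambda>i. if i < 1 then [x] ! i else e i) \<phi>" for x
    proof -
      have "x \<in> S \<longleftrightarrow> [x] \<in> (\<lambda>x. [x]) ` S" by auto
      then show ?thesis unfolding \<phi>(2) by simp
    qed
    have "\<iota> x \<in> \<iota> ` S \<longleftrightarrow> sat N (\<lambda>i. if i < 1 then [\<iota> x] ! i else \<iota> (e i)) \<phi>" for x
    proof -
      have "(\<lambda>i. if i < 1 then [\<iota> x] ! i else \<iota> (e i)) =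
          (\<lambda>i. \<iota> (if i < 1 then [x] ! i else e i))"
        by (rule ext) (simp split: if_split)
      then have "sat N (\<lambda>i. if i < 1 then [\<iota> x] ! i else \<iota> (e i)) \<phi> \<longleftrightarrow>
          sat M (\<lambda>i. if i < 1 then [x] ! i else e i) \<phi>"
        by (simp only: sat_N)
      then show ?thesis by (simp only: * inj_image_mem_iff[OF inj])
    qed
    note mem = this
    have "(\<lambda>x. [x]) ` (\<iota> ` S) = {xs. length xs = 1 \<and> set xs \<subseteq> dom N \<and>
        sat N (\<lambda>i. if i < 1 then xs ! i else \<iota> (e i)) \<phi>}" (is "_ = ?R")
    proof (intro set_eqI iffI)
      fix xs assume "xs \<in> (\<lambda>x. [x]) ` (\<iota> ` S)"
      then obtain x where x: "xs = [\<iota> x]" "\<iota> x \<in> \<iota> ` S" by blast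
      have "length xs = 1" "set xs \<subseteq> dom N" by (simp_all add: x(1) dom_N)
      then show "xs \<in> ?R" using x(2) unfolding mem x(1) by blast
    next
      fix xs assume xs: "xs \<in> ?R"
      then obtain y where y: "xs = [y]" by (auto simp: length_Suc_conv)
      then obtain x where x: "xs = [\<iota> x]" using xs by (auto simp: dom_N)
      have "\<iota> x \<in> \<iota> ` S" using xs unfolding mem x by blast
      then show "xs \<in> (\<lambda>x. [x]) ` (\<iota> ` S)" unfolding x by (rule imageI)
    qed
    then show ?thesis unfolding definable_def using \<phi>(1) by (intro exI conjI) (auto simp: dom_N)
  qed
  moreover have "\<iota> ` S \<subseteq> dom N" by (auto simp: dom_N)
  ultimately have "ball_combination N (\<iota> ` S)"
    using M(1) unfolding C_minimal_def by blast
  moreover have "ball_combination M (\<iota> -` B)" if "ball_combination N B" for B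
    using that
  proof induction
    case (ball B)
    have "\<iota> -` {x \<in> dom N. rel_interp N Div [\<iota> c, fun_interp N Minus [x, \<iota> a]]} =
        {x \<in> dom M. rel_interp M Div [c, fun_interp M Minus [x, a]]}"
      "\<iota> -` {x \<in> dom N. \<not> rel_interp N Div [fun_interp N Minus [x, \<iota> a], \<iota> c]} =
        {x \<in> dom M. \<not> rel_interp M Div [fun_interp M Minus [x, a], c]}"
      "\<iota> c \<noteq> fun_interp N Zero [] \<longleftrightarrow> c \<noteq> fun_interp M Zero []" for a c
      using inj M(2) by (auto simp: dom_N inj_eq fun_N rel_N)
    note images = this
    have "is_ball M (\<iota> -` B)"
      using ball[unfolded is_ball_def]
    proof (elim disjE bexE conjE)
      fix a c assume "a \<in> dom N" "c \<in> dom N"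
        and B: "B = {x \<in> dom N. rel_interp N Div [c, fun_interp N Minus [x, a]]}"
      then obtain a' c' where ac: "a = \<iota> a'" "c = \<iota> c'" by (auto simp: dom_N)
      have "\<exists>a\<in>dom M. \<exists>c\<in>dom M. \<iota> -` B =
          {x \<in> dom M. rel_interp M Div [c, fun_interp M Minus [x, a]]}"
        unfolding B ac images(1) M(2) by blast
      then show ?thesis unfolding is_ball_def by (rule disjI1)
    next
      fix a c assume "a \<in> dom N" "c \<in> dom N" and c: "c \<noteq> fun_interp N Zero []"
        and B: "B = {x \<in> dom N. \<not> rel_interp N Div [fun_interp N Minus [x, a], c]}"
      then obtain a' c' where ac: "a = \<iota> a'" "c = \<iota> c'" by (auto simp: dom_N)
      have "\<exists>a\<in>dom M. \<exists>c\<in>dom M. c \<noteq> fun_interp M Zero [] \<and> \<iota> -` B =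
          {x \<in> dom M. \<not> rel_interp M Div [fun_interp M Minus [x, a], c]}"
        using c unfolding B ac images(2,3) M(2) by blast
      then show ?thesis unfolding is_ball_def by (rule disjI2[OF disjI1])
    next
      assume "B = dom N"
      then have "\<iota> -` B = dom M" using M(2) by (auto simp: dom_N)
      then show ?thesis unfolding is_ball_def by blast
    qed
    then show ?case by (rule ball_combination.ball)
  next
    case (compl A)
    have "\<iota> -` (dom N - A) = dom M - \<iota> -` A" using M(2) by (auto simp: dom_N)
    then show ?case using compl by (simp add: ball_combination.compl)
  next
    case (union A B)
    then show ?case by (simp add: ball_combination.union)
  qed
  ultimately have "ball_combination M (\<iota> -` \<iota> ` S)" by blast
  then show ?thesis using inj by (simp add: inj_vimage_image_eq)
qed


section \<open>Units and residue classes\<close>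

locale valued_field =
  fixes v :: "'a::field \<Rightarrow> 'g::linordered_ab_group_add extended"
  assumes val: "valuation v"
begin

lemma v_mult: "v (x * y) = v x + v y"
  and v_add: "min (v x) (v y) \<le> v (x + y)"
  and v_eq_Pinf [simp]: "v x = Pinf \<longleftrightarrow> x = 0"
  and v_neq_Minf [simp]: "v x \<noteq> Minf"
  using val by (auto simp: valuation_def)

lemma v_surj: obtains x where "v x = Fin \<gamma>"
  using val unfolding valuation_def by blast

lemma v_nonzero: assumes "x \<noteq> 0" obtains \<gamma> where "v x = Fin \<gamma>"
  using assms by (cases "v x") auto

lemma v_zero [simp]: "v 0 = Pinf"
  by simp

lemma v_one: "v 1 = Fin 0"
proof -
  obtain \<gamma> where "v 1 = Fin \<gamma>" using v_nonzero[of 1] by auto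
  with v_mult[of 1 1] show ?thesis by simp
qed

lemma v_minus [simp]: "v (- x) = v x"
proof -
  obtain \<gamma> where "v (-1) = Fin \<gamma>" using v_nonzero[of "-1"] by auto
  with v_mult[of "-1" "-1"] have "v (-1) = Fin 0" by (simp add: v_one)
  with v_mult[of "-1" x] show ?thesis by (cases "v x") auto
qed

lemma v_diff_commute: "v (x - y) = v (y - x)"
  using v_minus[of "x - y"] by simp

lemma v_add_gt: "\<gamma> < v x \<Longrightarrow> \<gamma> < v y \<Longrightarrow> \<gamma> < v (x + y)"
  using v_add[of x y] by (meson less_le_trans min_less_iff_conj)

lemma v_add_ge: "\<gamma> \<le> v x \<Longrightarrow> \<gamma> \<le> v y \<Longrightarrow> \<gamma> \<le> v (x + y)"
  using v_add[of x y] by (meson order_trans min.boundedI)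

lemma v_diff_ge: "\<gamma> \<le> v x \<Longrightarrow> \<gamma> \<le> v y \<Longrightarrow> \<gamma> \<le> v (x - y)"
  using v_add_ge[of \<gamma> x "- y"] by simp

lemma v_add_eq: assumes "v x < v y" shows "v (x + y) = v x"
proof (rule ccontr)
  assume "v (x + y) \<noteq> v x"
  moreover have "v x \<le> v (x + y)" using v_add_ge[of "v x" x y] assms by simp
  ultimately have "v x < v (x + y)" by simp
  then have "v x < v ((x + y) + - y)" by (rule v_add_gt) (simp add: assms)
  then show False by simp
qed

lemma v_mult_le_iff: assumes "z \<noteq> 0" shows "v (z * x) \<le> v (z * y) \<longleftrightarrow> v x \<le> v y"
proof -
  obtain \<gamma> where "v z = Fin \<gamma>" using v_nonzero assms by blast
  then show ?thesis by (cases "v x"; cases "v y") (auto simp: v_mult)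
qed

lemma v_mult_less_iff: "z \<noteq> 0 \<Longrightarrow> v (z * x) < v (z * y) \<longleftrightarrow> v x < v y"
  using v_mult_le_iff[of z y x] by (simp add: not_le[symmetric])

text \<open>By non-triviality some value is nonzero; adding it or its negative, whichever is
  negative, moves below \<open>\<gamma>\<close>.\<close>

lemma v_below: obtains x where "x \<noteq> 0" "v x < Fin \<gamma>"
proof -
  obtain x0 where x0: "x0 \<noteq> 0" "v x0 \<noteq> Fin 0"
    using val by (auto simp: valuation_def)
  obtain \<delta> where \<delta>: "v x0 = Fin \<delta>" using v_nonzero x0(1) by blast
  define \<epsilon> where "\<epsilon> = (if \<delta> < 0 then \<delta> else - \<delta>)"
  have "\<epsilon> < 0" using x0 \<delta> by (auto simp: \<epsilon>_def)
  obtain x where x: "v x = Fin (\<gamma> + \<epsilon>)" using v_surj by blast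
  have "x \<noteq> 0" using x by auto
  moreover have "v x < Fin \<gamma>" using x \<open>\<epsilon> < 0\<close> by simp
  ultimately show ?thesis by (rule that)
qed

text \<open>Written with \<open>v 1\<close> rather than \<open>Fin 0\<close>, so that membership
  compares the values of two terms and falls under \<open>dform_val_eq\<close>.\<close>

definition units :: "'a set" where "units = {u. v u = v 1}"

lemma units_nonzero: "u \<in> units \<Longrightarrow> u \<noteq> 0"
  by (auto simp: units_def v_one)

lemma one_units [simp]: "1 \<in> units"
  by (simp add: units_def)

lemma v_units_mult [simp]: "u \<in> units \<Longrightarrow> v (u * x) = v x" "u \<in> units \<Longrightarrow> v (x * u) = v x"
  by (cases "v x"; simp add: units_def v_mult v_one)+

lemma units_mult: "u \<in> units \<Longrightarrow> w \<in> units \<Longrightarrow> u * w \<in> units"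
  using v_units_mult[of u w] by (simp add: units_def)

lemma units_inverse: assumes "u \<in> units" shows "inverse u \<in> units"
  using v_units_mult(1)[OF assms, of "inverse u"] units_nonzero[OF assms] by (simp add: units_def)

lemma units_power: "u \<in> units \<Longrightarrow> u ^ n \<in> units"
  by (induction n) (auto intro: units_mult)

lemma units_root: assumes "x ^ n \<in> units" "n > 0" shows "x \<in> units"
proof (rule ccontr)
  assume "x \<notin> units"
  then consider "v x < v 1" | "v 1 < v x" unfolding units_def by fastforce
  then have "v (x ^ Suc k) \<noteq> v 1" for k
  proof cases
    case 1
    then have x: "x \<noteq> 0" by (auto simp: v_one)
    have "v (x ^ Suc k) < v 1"
    proof (induction k)
      case (Suc k)
      have "v (x * x ^ Suc k) < v (x * 1)" using Suc by (simp only: v_mult_less_iff[OF x])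
      with 1 show ?case by simp
    qed (use 1 in simp)
    then show ?thesis by simp
  next
    case 2
    show ?thesis
    proof (cases "x = 0")
      case x: False
      have "v 1 < v (x ^ Suc k)"
      proof (induction k)
        case (Suc k)
        have "v (x * 1) < v (x * x ^ Suc k)" using Suc by (simp only: v_mult_less_iff[OF x])
        with 2 show ?case by simp
      qed (use 2 in simp)
      then show ?thesis by simp
    qed (simp add: v_one)
  qed
  then show False using assms by (cases n) (auto simp: units_def)
qed

text \<open>Congruence modulo the maximal ideal, taken on the whole field so that it is an
  equivalence relation without side conditions.\<close>

definition residue_eq :: "'a \<Rightarrow> 'a \<Rightarrow> bool" where
  "residue_eq x y \<longleftrightarrow> v 1 < v (x - y)"

definition residue_class :: "'a \<Rightarrow> 'a set" where
  "residue_class x = {y. residue_eq x y}"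

lemma residue_eq_refl [simp]: "residue_eq x x"
  by (simp add: residue_eq_def v_one)

lemma residue_eq_sym: "residue_eq x y \<Longrightarrow> residue_eq y x"
  by (simp add: residue_eq_def v_diff_commute)

lemma residue_eq_trans: "residue_eq x y \<Longrightarrow> residue_eq y z \<Longrightarrow> residue_eq x z"
  unfolding residue_eq_def using v_add_gt[of "v 1" "x - y" "y - z"] by simp

lemma residue_class_eq_iff: "residue_class x = residue_class y \<longleftrightarrow> residue_eq x y"
  unfolding residue_class_def using residue_eq_refl residue_eq_sym residue_eq_trans by blast

lemma residue_eq_units: assumes "residue_eq x y" "x \<in> units" shows "y \<in> units"
proof -
  have "v (x + (y - x)) = v x"
    using assms by (intro v_add_eq) (simp add: residue_eq_def units_def v_diff_commute)
  then show ?thesis using assms by (simp add: units_def)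
qed

lemma residue_eq_mult_left: "u \<in> units \<Longrightarrow> residue_eq (u * x) (u * y) \<longleftrightarrow> residue_eq x y"
  by (simp add: residue_eq_def right_diff_distrib[symmetric])

lemma residue_eq_mult:
  assumes "residue_eq x x'" "residue_eq y y'" "x \<in> units" "y \<in> units"
  shows "residue_eq (x * y) (x' * y')"
proof -
  have "residue_eq (x * y) (x * y')"
    using assms by (simp add: residue_eq_mult_left)
  moreover have "residue_eq (y' * x) (y' * x')"
    using assms residue_eq_units by (simp add: residue_eq_mult_left)
  ultimately show ?thesis by (metis mult.commute residue_eq_trans)
qed

lemma residue_eq_power:
  assumes "residue_eq x y" "x \<in> units" shows "residue_eq (x ^ n) (y ^ n)"
  by (induction n) (auto intro!: residue_eq_mult units_power assms)

lemma residue_eq_inverse: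
  assumes "residue_eq x y" "x \<in> units" shows "residue_eq (inverse x) (inverse y)"
proof -
  have y: "y \<in> units" using assms residue_eq_units by blast
  have "(x * y) * inverse x = y" "(x * y) * inverse y = x"
    using units_nonzero[OF y] units_nonzero[OF assms(2)] by simp_all
  then have "residue_eq ((x * y) * inverse x) ((x * y) * inverse y)"
    using assms(1) by (simp only: residue_eq_sym)
  then show ?thesis using assms y by (simp add: residue_eq_mult_left units_mult)
qed

text \<open>Finiteness in the residue field: elements count only up to congruence, and those outside
  the units are ignored.\<close>

definition small :: "'a set \<Rightarrow> bool" where
  "small S \<longleftrightarrow> finite (residue_class ` (S \<inter> units))"

lemma small_mono: "small S \<Longrightarrow> T \<inter> units \<subseteq> S \<Longrightarrow> small T"
  unfolding small_def by (erule finite_subset[rotated]) auto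

lemma small_Un: "small S \<Longrightarrow> small T \<Longrightarrow> small (S \<union> T)"
  by (simp add: small_def Int_Un_distrib2 image_Un)

text \<open>Since \<open>f\<close> respects congruence, it induces a map \<open>g\<close> on residue
  classes, defined through chosen representatives.\<close>

lemma small_image:
  assumes "small S" "\<And>x. x \<in> S \<inter> units \<Longrightarrow> f x \<in> units"
    and "\<And>x y. x \<in> S \<inter> units \<Longrightarrow> y \<in> units \<Longrightarrow> residue_eq x y \<Longrightarrow> residue_eq (f x) (f y)"
  shows "small (f ` (S \<inter> units))"
proof -
  define g where "g c = residue_class (f (SOME x. x \<in> S \<inter> units \<and> residue_class x = c))" for c
  have "residue_class (f x) = g (residue_class x)" if x: "x \<in> S \<inter> units" for x
  proof -
    define y where "y = (SOME y. y \<in> S \<inter> units \<and> residue_class y = residue_class x)"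
    have "y \<in> S \<inter> units \<and> residue_class y = residue_class x"
      unfolding y_def by (rule someI) (use x in auto)
    then show ?thesis
      unfolding g_def y_def[symmetric] using assms(3)[OF x, of y] x
      by (auto simp: residue_class_eq_iff intro: residue_eq_sym)
  qed
  then have "residue_class ` (f ` (S \<inter> units) \<inter> units) \<subseteq> g ` residue_class ` (S \<inter> units)"
    by auto
  then show ?thesis using assms(1) unfolding small_def by (meson finite_imageI finite_subset)
qed

lemma v_sum_gt: "finite A \<Longrightarrow> (\<And>k. k \<in> A \<Longrightarrow> Fin \<gamma> < v (f k)) \<Longrightarrow> Fin \<gamma> < v (sum f A)"
  by (induction A rule: finite_induct) (auto intro: v_add_gt)

lemma v_of_nat_ge: "v 1 \<le> v (of_nat n)"
  by (induction n) (auto intro: v_add_ge)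

text \<open>At most one of \<open>2\<close>, \<open>3\<close> and \<open>5\<close> lies in the
  maximal ideal, and any two of them are coprime, with an explicit Bezout identity.\<close>

lemma coprime_unit_exponents:
  obtains m n a b :: nat where "m \<ge> 2" "n \<ge> 2" "of_nat m \<in> units" "of_nat n \<in> units"
    "m * a = n * b + 1"
proof -
  \<comment> \<open>If \<open>k\<close> lies in the maximal ideal, so do its multiples, and one plus
    such a multiple is a unit.\<close>
  have unit: "of_nat (n + 1) \<in> units" if k: "of_nat k \<notin> units" and dvd: "k dvd n" for k n :: nat
  proof -
    have k: "v 1 < v (of_nat k)" using k v_of_nat_ge[of k] by (simp add: units_def)
    obtain j where "n = k * j" using dvd by blast
    have "v 1 < v (of_nat n)"
    proof (cases "(of_nat k :: 'a) = 0")
      case False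
      have "v (of_nat k * 1) \<le> v (of_nat k * of_nat j)"
        using v_of_nat_ge[of j] by (simp only: v_mult_le_iff[OF False])
      then show ?thesis using k \<open>n = k * j\<close> by simp
    qed (use \<open>n = k * j\<close> in \<open>simp add: v_one\<close>)
    then have "v (1 + of_nat n) = v 1" by (intro v_add_eq) simp
    then show ?thesis by (simp add: units_def)
  qed
  show ?thesis
  proof (cases "of_nat 2 \<in> units")
    case two: True
    show ?thesis
    proof (cases "of_nat 3 \<in> units")
      case True
      show ?thesis by (rule that[of 3 2 1 1]) (use two True in simp_all)
    next
      case False
      have "of_nat (5 * 1) \<in> units"
      proof (rule ccontr)
        assume "of_nat (5 * 1) \<notin> units"
        \<comment> \<open>Then \<open>6\<close> would be a unit, and so would its factor
          \<open>3\<close>.\<close>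
        then have "of_nat (5 + 1) \<in> units" by (intro unit[of 5]) auto
        then have "of_nat 2 * of_nat 3 \<in> units" by simp
        then show False using False two v_units_mult(1)[OF two, of "of_nat 3"]
          by (simp add: units_def)
      qed
      then show ?thesis by (intro that[of 5 2 1 2]) (use two in simp_all)
    qed
  next
    case False
    have "of_nat (2 + 1) \<in> units" "of_nat (4 + 1) \<in> units"
      using unit[OF False, of 2] unit[OF False, of 4] by auto
    then show ?thesis by (intro that[of 3 5 2 1]) simp_all
  qed
qed

text \<open>On a finite set of residue classes, choosing roots is injective, hence surjective; but then
  both the chosen root and its multiple by \<open>\<zeta>\<close> are chosen for the same class.\<close>

lemma no_small_root_closed:
  assumes "small T" "T \<subseteq> units" "T \<noteq> {}"
    and \<zeta>: "\<zeta> \<in> units" "residue_eq (\<zeta> ^ n) 1" "\<not> residue_eq \<zeta> 1"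
    and root: "\<And>t. t \<in> T \<Longrightarrow> \<exists>y\<in>T. \<zeta> * y \<in> T \<and> residue_eq (y ^ n) t"
  shows False
proof -
  define C where "C = residue_class ` T"
  have fin: "finite C" using assms(1,2) by (simp add: small_def C_def Int_absorb2)
  have "\<exists>y. y \<in> T \<and> \<zeta> * y \<in> T \<and> residue_class (y ^ n) = c" if "c \<in> C" for c
    using that root unfolding C_def by (force simp: residue_class_eq_iff)
  then obtain r where r: "\<And>c. c \<in> C \<Longrightarrow> r c \<in> T \<and> \<zeta> * r c \<in> T \<and> residue_class (r c ^ n) = c"
    by metis
  have eq: "c = c'" if "c \<in> C" "c' \<in> C" "residue_class (r c ^ n) = residue_class (r c' ^ n)" for c c'
    using that r by metis
  have "inj_on (\<lambda>c. residue_class (r c)) C"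
  proof (rule inj_onI)
    fix c c' assume c: "c \<in> C" "c' \<in> C" "residue_class (r c) = residue_class (r c')"
    then have "residue_eq (r c ^ n) (r c' ^ n)"
      using r assms(2) by (intro residue_eq_power) (auto simp: residue_class_eq_iff)
    with c eq show "c = c'" by (simp add: residue_class_eq_iff)
  qed
  moreover have "(\<lambda>c. residue_class (r c)) ` C \<subseteq> C" using r by (auto simp: C_def)
  ultimately have surj: "(\<lambda>c. residue_class (r c)) ` C = C"
    using fin by (simp add: endo_inj_surj)
  obtain c where c: "c \<in> C" using assms(3) by (auto simp: C_def)
  have rc: "r c \<in> units" using r[OF c] assms(2) by blast
  have "residue_class (\<zeta> * r c) \<in> C" using r[OF c] by (auto simp: C_def)
  then have "residue_class (\<zeta> * r c) \<in> (\<lambda>c. residue_class (r c)) ` C" by (simp only: surj)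
  then obtain c' where c': "c' \<in> C" "residue_eq (\<zeta> * r c) (r c')"
    by (auto simp: residue_class_eq_iff)
  have "residue_eq ((\<zeta> * r c) ^ n) (r c' ^ n)"
    using c' rc \<zeta> by (intro residue_eq_power) (auto intro: units_mult)
  moreover have "residue_eq ((\<zeta> * r c) ^ n) (1 * r c ^ n)"
    unfolding power_mult_distrib using \<zeta> rc by (intro residue_eq_mult) (auto intro: units_power)
  ultimately have "residue_eq (r c ^ n) (r c' ^ n)"
    using residue_eq_sym residue_eq_trans by (metis mult_1)
  then have "c = c'" using c c' eq by (simp add: residue_class_eq_iff)
  then have "residue_eq (r c * \<zeta>) (r c * 1)" using c' by (simp add: mult.commute)
  then show False using \<zeta>(3) by (simp only: residue_eq_mult_left[OF rc])
qed

text \<open>The coset of a unit \<open>c\<close> outside \<open>G\<close> would lie in the small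
  complement. Translated back, \<open>G\<close> would be small, and with its complement all the
  units.\<close>

lemma subgroup_not_small:
  assumes G: "G \<subseteq> units" "\<And>x y. x \<in> G \<Longrightarrow> y \<in> G \<Longrightarrow> x * y \<in> G" "\<And>x. x \<in> G \<Longrightarrow> inverse x \<in> G"
    and "small (- G)"
    and units: "\<not> small units"
  shows "G = units"
proof (rule ccontr)
  assume "G \<noteq> units"
  then obtain c where c: "c \<in> units" "c \<notin> G" using G(1) by blast
  have c0: "c \<noteq> 0" using c units_nonzero by blast
  have "(\<lambda>x. inverse c * x) ` (- G \<inter> units) \<supseteq> G"
  proof
    fix x assume x: "x \<in> G"
    have "c * x \<notin> G"
    proof
      assume "c * x \<in> G"
      then have "c * x * inverse x \<in> G" using G x by blast
      then show False using c units_nonzero[of x] x G(1) by (auto simp: mult.assoc)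
    qed
    then have "c * x \<in> - G \<inter> units" using c x G(1) units_mult by blast
    then show "x \<in> (\<lambda>x. inverse c * x) ` (- G \<inter> units)"
      using c0 by (intro image_eqI[of _ _ "c * x"]) (auto simp: mult.assoc[symmetric])
  qed
  moreover have "small ((\<lambda>x. inverse c * x) ` (- G \<inter> units))"
    using assms(4) c
    by (intro small_image) (auto simp: residue_eq_mult_left units_inverse intro: units_mult units_inverse)
  ultimately have "small G" using small_mono by blast
  then have "small (G \<union> - G)" using assms(4) by (rule small_Un)
  then show False using units small_mono by auto
qed

end


section \<open>The filter at infinity\<close>

context valued_field
begin

text \<open>Infinity is approached as \<open>v x\<close> decreases: the basic sets are the
  complements of closed balls about \<open>0\<close>.\<close>

definition at_inf :: "'a filter" where
  "at_inf = (INF \<gamma>. principal {x. v x < Fin \<gamma>})"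

lemma eventually_at_inf: "eventually P at_inf \<longleftrightarrow> (\<exists>\<gamma>. \<forall>x. v x < Fin \<gamma> \<longrightarrow> P x)"
proof -
  have "\<exists>\<gamma>. principal {x. v x < Fin \<gamma>} \<le>
      inf (principal {x. v x < Fin \<alpha>}) (principal {x. v x < Fin \<beta>})" for \<alpha> \<beta>
    by (rule exI[of _ "min \<alpha> \<beta>"]) (auto simp: min_def order_less_le_trans split: if_splits)
  then show ?thesis
    unfolding at_inf_def by (subst eventually_INF_base) (auto simp: eventually_principal)
qed

text \<open>The threshold becomes the value of a field element, over which first-order formulas can
  quantify.\<close>

lemma eventually_at_inf_iff_element:
  "eventually P at_inf \<longleftrightarrow> (\<exists>c. c \<noteq> 0 \<and> (\<forall>x. v x < v c \<longrightarrow> P x))"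
proof
  assume "eventually P at_inf"
  then obtain \<gamma> where \<gamma>: "\<forall>x. v x < Fin \<gamma> \<longrightarrow> P x" by (auto simp: eventually_at_inf)
  obtain c where "v c = Fin \<gamma>" using v_surj by blast
  with \<gamma> show "\<exists>c. c \<noteq> 0 \<and> (\<forall>x. v x < v c \<longrightarrow> P x)"
    by (intro exI[of _ c]) auto
next
  assume "\<exists>c. c \<noteq> 0 \<and> (\<forall>x. v x < v c \<longrightarrow> P x)"
  then obtain c where c: "c \<noteq> 0" "\<forall>x. v x < v c \<longrightarrow> P x" by blast
  then obtain \<gamma> where "v c = Fin \<gamma>" using v_nonzero by blast
  with c show "eventually P at_inf" by (auto simp: eventually_at_inf)
qed

lemma at_inf_neq_bot: "at_inf \<noteq> bot"
  unfolding eventually_False[symmetric] eventually_at_inf using v_below by blast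

lemma eventually_at_inf_scale:
  assumes "eventually P at_inf" "u \<noteq> 0"
  shows "eventually (\<lambda>x. P (u * x)) at_inf"
proof -
  obtain c where c: "c \<noteq> 0" "\<forall>x. v x < v c \<longrightarrow> P x"
    using assms(1) by (auto simp: eventually_at_inf_iff_element)
  have "v (u * x) < v c" if "v x < v (c / u)" for x
    using that v_mult_less_iff[OF assms(2), of x "c / u"] assms(2) by simp
  then show ?thesis unfolding eventually_at_inf_iff_element
    using c assms(2) by (intro exI[of _ "c / u"]) auto
qed

text \<open>Once \<open>v x\<close> is below \<open>v a\<close>, the value of \<open>x - a\<close>
  is \<open>v x\<close>. Hence a ball of radius other than \<open>Minf\<close> avoids a neighborhood
  of infinity.\<close>

lemma ball_at_inf:
  assumes "\<gamma> \<noteq> Minf" obtains \<delta> where "\<And>x. v x < Fin \<delta> \<Longrightarrow> v (x - a) < \<gamma>"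
proof -
  \<comment> \<open>Both \<open>v a\<close> and \<open>\<gamma>\<close> may be \<open>Pinf\<close>,
    so group elements below them are used instead.\<close>
  obtain \<alpha> where \<alpha>: "Fin \<alpha> \<le> v a" by (cases "v a") auto
  obtain \<beta> where \<beta>: "Fin \<beta> \<le> \<gamma>" using assms by (cases \<gamma>) auto
  have "v (x - a) < \<gamma>" if x: "v x < Fin (min \<alpha> \<beta>)" for x
  proof -
    have "v x < Fin \<alpha>" "v x < Fin \<beta>"
      using x by (auto elim!: order_less_le_trans)
    then have "v x < v a" "v x < \<gamma>" using \<alpha> \<beta> by (auto elim: order_less_le_trans)
    then show ?thesis using v_add_eq[of x "- a"] by simp
  qed
  then show ?thesis by (rule that)
qed

lemma closed_ball_at_inf:
  assumes "\<gamma> \<noteq> Minf" shows "eventually (\<lambda>x. x \<notin> closed_ball v a \<gamma>) at_inf"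
proof -
  obtain \<delta> where "\<And>x. v x < Fin \<delta> \<Longrightarrow> v (x - a) < \<gamma>" using ball_at_inf assms by blast
  then show ?thesis
    by (auto simp: eventually_at_inf closed_ball_def not_le)
qed

lemma open_ball_at_inf:
  "eventually (\<lambda>x. x \<in> open_ball v a \<gamma>) at_inf \<or> eventually (\<lambda>x. x \<notin> open_ball v a \<gamma>) at_inf"
proof (cases "\<gamma> = Minf")
  case True
  have "Minf < v (x - a)" for x by (cases "v (x - a)") auto
  then show ?thesis using True by (simp add: open_ball_def)
next
  case False
  then obtain \<delta> where "\<And>x. v x < Fin \<delta> \<Longrightarrow> v (x - a) < \<gamma>" using ball_at_inf by blast
  then have "eventually (\<lambda>x. x \<notin> open_ball v a \<gamma>) at_inf"
    by (auto simp: eventually_at_inf open_ball_def not_less intro: order_less_imp_le)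
  then show ?thesis ..
qed

text \<open>Treats closed and open balls alike. \<open>C\<close> stands for the ball being large: it
  then contains all units as soon as it contains one. Otherwise it lies in a single residue
  class.\<close>

lemma small_or_cosmall_ball:
  assumes near: "\<And>x b. b \<in> B \<Longrightarrow> x \<in> units \<Longrightarrow> b \<in> units \<Longrightarrow> x \<in> B \<or> \<not> C"
    and far: "\<And>x b. \<not> C \<Longrightarrow> x \<in> B \<Longrightarrow> b \<in> B \<Longrightarrow> residue_eq x b"
  shows "small B \<or> small (- B)"
proof (cases "B \<inter> units = {}")
  case False
  then obtain b where b: "b \<in> B" "b \<in> units" by blast
  show ?thesis
  proof (cases C)
    case True
    then have "- B \<inter> units = {}" using near b by blast
    then show ?thesis by (simp add: small_def)
  next
    case False
    then have "residue_class x = residue_class b" if "x \<in> B" for x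
      using far b that by (simp add: residue_class_eq_iff)
    then have "residue_class ` (B \<inter> units) \<subseteq> {residue_class b}" by blast
    then show ?thesis unfolding small_def using finite_subset by blast
  qed
qed (simp add: small_def)

lemma closed_ball_small: "small (closed_ball v a \<gamma>) \<or> small (- closed_ball v a \<gamma>)"
proof (rule small_or_cosmall_ball[where C = "\<gamma> \<le> v 1"])
  fix x b assume b: "b \<in> closed_ball v a \<gamma>" "b \<in> units" and x: "x \<in> units"
  show "x \<in> closed_ball v a \<gamma> \<or> \<not> \<gamma> \<le> v 1"
  proof (cases "\<gamma> \<le> v 1")
    case True
    have "v 1 \<le> v (x - b)" using b x by (intro v_diff_ge) (simp_all add: units_def)
    then have "\<gamma> \<le> v ((x - b) + (b - a))"
      using b True by (intro v_add_ge) (auto simp: closed_ball_def)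
    then show ?thesis by (simp add: closed_ball_def)
  qed simp
next
  fix x b assume "\<not> \<gamma> \<le> v 1" "x \<in> closed_ball v a \<gamma>" "b \<in> closed_ball v a \<gamma>"
  then have "v 1 < v ((x - a) - (b - a))"
    using v_diff_ge[of \<gamma> "x - a" "b - a"] by (auto simp: closed_ball_def)
  then show "residue_eq x b" by (simp add: residue_eq_def)
qed

lemma open_ball_small: "small (open_ball v a \<gamma>) \<or> small (- open_ball v a \<gamma>)"
proof (rule small_or_cosmall_ball[where C = "\<gamma> < v 1"])
  fix x b assume b: "b \<in> open_ball v a \<gamma>" "b \<in> units" and x: "x \<in> units"
  show "x \<in> open_ball v a \<gamma> \<or> \<not> \<gamma> < v 1"
  proof (cases "\<gamma> < v 1")
    case True
    have "v 1 \<le> v (x - b)" using b x by (intro v_diff_ge) (simp_all add: units_def)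
    then have "\<gamma> < v ((x - b) + (b - a))"
      using b True by (intro v_add_gt) (auto simp: open_ball_def)
    then show ?thesis by (simp add: open_ball_def)
  qed simp
next
  fix x b assume *: "\<not> \<gamma> < v 1" "x \<in> open_ball v a \<gamma>" "b \<in> open_ball v a \<gamma>"
  then have "v 1 < v (x - a)" "v 1 < v (a - b)"
    by (auto simp: open_ball_def v_diff_commute[of a b])
  then have "v 1 < v ((x - a) + (a - b))" by (rule v_add_gt)
  then show "residue_eq x b" by (simp add: residue_eq_def)
qed

end


section \<open>Definable sets in C-minimal valued fields\<close>

locale C_minimal_vf =
  fixes L :: "('f, 'r) vf_language"
    and M :: "('f, 'r, 'a::alg_closed_field) fo_struct"
    and v :: "'a \<Rightarrow> 'g::linordered_ab_group_add extended"
  assumes C_minimal_vf: "C_minimal_valued_field L M v"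

sublocale C_minimal_vf \<subseteq> valued_field v
  using C_minimal_vf by unfold_locales (simp add: C_minimal_valued_field_def)

context C_minimal_vf
begin

lemma expands: "expands_valued_field M v"
  using C_minimal_vf by (simp add: C_minimal_valued_field_def)

lemma dom_M: "dom M = UNIV"
  using expands by (simp add: expands_valued_field_def)

lemma dform_units: "dterm L M t \<Longrightarrow> dform L M (\<lambda>e. t e \<in> units)"
  unfolding units_def mem_Collect_eq by (intro dform_val_eq[OF expands] dterm_const)

lemma dform_residue_eq: "dterm L M t \<Longrightarrow> dterm L M u \<Longrightarrow> dform L M (\<lambda>e. residue_eq (t e) (u e))"
  unfolding residue_eq_def
  by (intro dform_less[OF expands] dterm_const dterm_arith[OF expands])

lemmas dform_intros =
  dform_Ex[OF _ dom_M] dform_All[OF _ dom_M] dform_imp dform_conj dform_Not dform_eq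
  dform_le[OF expands] dform_less[OF expands] dform_val_eq[OF expands]
  dform_units dform_residue_eq dterm_var dterm_const dterm_arith[OF expands] dterm_power[OF expands]

text \<open>Both alternatives hold for balls and survive complements and unions.\<close>

lemma ball_combination_dichotomy:
  assumes "ball_combination M S"
  shows "(small S \<or> small (- S)) \<and>
    (eventually (\<lambda>x. x \<in> S) at_inf \<or> eventually (\<lambda>x. x \<notin> S) at_inf)"
  using assms
proof induction
  case (ball B)
  then show ?case
    using closed_ball_small open_ball_small closed_ball_at_inf open_ball_at_inf
    unfolding is_ball_iff[OF val expands] by metis
next
  case (compl A)
  have "dom M - A = - A" using dom_M by auto
  with compl show ?case by auto
next
  case (union A B)
  have "small (- (A \<union> B))" if "small (- A) \<or> small (- B)"
    using that by (auto elim: small_mono)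
  moreover have "eventually (\<lambda>x. x \<in> A \<union> B) at_inf"
    if "eventually (\<lambda>x. x \<in> A) at_inf \<or> eventually (\<lambda>x. x \<in> B) at_inf"
    using that by (auto elim: eventually_mono)
  moreover have "eventually (\<lambda>x. x \<notin> A \<union> B) at_inf"
    if "eventually (\<lambda>x. x \<notin> A) at_inf" "eventually (\<lambda>x. x \<notin> B) at_inf"
    using eventually_conj[OF that] by (auto elim: eventually_mono)
  ultimately show ?case using union.IH small_Un by blast
qed

text \<open>All later uses of C-minimality go through these two tests, among the units and at
  infinity.\<close>

lemma dform_dichotomy:
  assumes "dform L M (\<lambda>e. Q (e 0))"
  shows "small {x. Q x} \<or> small {x. \<not> Q x}"
    and "eventually Q at_inf \<or> eventually (\<lambda>x. \<not> Q x) at_inf"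
proof -
  have "ball_combination M {x. Q x}"
    using C_minimal_ball_combination[of L M "{x. Q x}"] C_minimal_vf assms dom_M
    by (simp add: C_minimal_valued_field_def)
  then show "small {x. Q x} \<or> small {x. \<not> Q x}"
    "eventually Q at_inf \<or> eventually (\<lambda>x. \<not> Q x) at_inf"
    using ball_combination_dichotomy[of "{x. Q x}"] by (simp_all add: Collect_neg_eq)
qed

text \<open>Take a root of the sum of the powers of \<open>X\<close> below \<open>n\<close>. If it
  were congruent to \<open>1\<close>, the sum of the differences \<open>\<zeta> ^ k - 1\<close>,
  which is \<open>- of_nat n\<close>, would lie in the maximal ideal.\<close>

lemma root_of_unity:
  assumes "n \<ge> 2" "of_nat n \<in> units"
  obtains \<zeta> where "\<zeta> \<in> units" "\<zeta> ^ n = 1" "\<not> residue_eq \<zeta> 1"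
proof -
  obtain \<zeta> :: 'a where "(\<Sum>k\<le>n - 1. 1 * \<zeta> ^ k) = 0"
    using alg_closed[of "n - 1" "\<lambda>_. 1"] assms(1) by auto
  moreover have "{..n - 1} = {..<n}" using assms(1) by auto
  ultimately have sum: "(\<Sum>k<n. \<zeta> ^ k) = 0" by simp
  then have \<zeta>: "\<zeta> ^ n = 1" using one_diff_power_eq[of \<zeta> n] by simp
  then have unit: "\<zeta> \<in> units" using units_root[of \<zeta> n] assms(1) by simp
  have "\<not> residue_eq \<zeta> 1"
  proof
    assume "residue_eq \<zeta> 1"
    then have "v 1 < v (\<zeta> ^ k - 1)" for k
      using residue_eq_power[of \<zeta> 1 k] unit by (simp add: residue_eq_def)
    then have "v 1 < v (\<Sum>k<n. \<zeta> ^ k - 1)"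
      unfolding v_one by (intro v_sum_gt) auto
    moreover have "(\<Sum>k<n. \<zeta> ^ k - 1) = - of_nat n"
      by (simp add: sum_subtractf sum)
    ultimately show False using assms(2) by (simp add: units_def)
  qed
  with \<zeta> unit show ?thesis by (intro that)
qed

text \<open>Along with \<open>y\<close>, its multiple by a nontrivial root of unity is an
  \<open>n\<close>-th root of the same element, so \<open>no_small_root_closed\<close>
  applies.\<close>

lemma root_closed_empty:
  assumes "small T" "T \<subseteq> units" and root: "\<And>y n. n > 0 \<Longrightarrow> y ^ n \<in> T \<Longrightarrow> y \<in> T"
  shows "T = {}"
proof (rule ccontr)
  assume "T \<noteq> {}"
  obtain n :: nat where n: "n \<ge> 2" "of_nat n \<in> units"
    using coprime_unit_exponents by metis
  obtain \<zeta> where \<zeta>: "\<zeta> \<in> units" "\<zeta> ^ n = 1" "\<not> residue_eq \<zeta> 1"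
    using root_of_unity n by metis
  have "\<exists>y\<in>T. \<zeta> * y \<in> T \<and> residue_eq (y ^ n) t" if "t \<in> T" for t
  proof -
    obtain y where y: "y ^ n = t" using nth_root_exists[of n t] n by auto
    have "(\<zeta> * y) ^ n \<in> T" "y ^ n \<in> T"
      using that y \<zeta> by (simp_all add: power_mult_distrib)
    then show ?thesis using root[of n] n y by (intro bexI[of _ y]) auto
  qed
  then show False
    using no_small_root_closed[of T \<zeta> n] assms \<zeta> \<open>T \<noteq> {}\<close> by auto
qed

text \<open>The residue field is infinite, because the units are closed under roots. Hence no set is
  small together with its complement.\<close>

lemma units_not_small: "\<not> small units"
  using root_closed_empty[of units] units_root one_units by blast

end


section \<open>Factorization of a single function\<close>

context C_minimal_vf
begin

text \<open>\<open>x \<in> S n\<close> says that \<open>x\<close> has, up to congruence, an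
  \<open>n\<close>-th root lying in every \<open>H i\<close> that contains \<open>x\<close>, that
  is, a root of no higher rank. Definability enters only through the dichotomies for
  \<open>H i\<close> and \<open>S n\<close>.\<close>

lemma chain_of_unit_subgroups:
  fixes H :: "'i \<Rightarrow> 'a set" and I :: "'i set"
  defines "S \<equiv> \<lambda>n. {x \<in> units. \<exists>y\<in>units. residue_eq (y ^ n) x \<and>
    \<not> (\<exists>i\<in>I. x \<in> H i \<and> y \<notin> H i)}"
  assumes units: "\<And>i. i \<in> I \<Longrightarrow> H i \<subseteq> units"
    and mult: "\<And>i x y. i \<in> I \<Longrightarrow> x \<in> H i \<Longrightarrow> y \<in> H i \<Longrightarrow> x * y \<in> H i"
    and inv: "\<And>i x. i \<in> I \<Longrightarrow> x \<in> H i \<Longrightarrow> inverse x \<in> H i"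
    and one: "\<And>i. i \<in> I \<Longrightarrow> 1 \<in> H i"
    and saturated: "\<And>i x y. i \<in> I \<Longrightarrow> x \<in> H i \<Longrightarrow> residue_eq x y \<Longrightarrow> y \<in> H i"
    and chain: "\<And>i j. i \<in> I \<Longrightarrow> j \<in> I \<Longrightarrow> H i \<subseteq> H j \<or> H j \<subseteq> H i"
    and cover: "\<And>x. x \<in> units \<Longrightarrow> \<exists>i\<in>I. x \<in> H i"
    and small_H: "\<And>i. i \<in> I \<Longrightarrow> small (H i) \<or> small (- H i)"
    and small_S: "\<And>n. small (S n) \<or> small (- S n)"
  shows "\<exists>i\<in>I. H i = units"
proof (rule ccontr)
  assume "\<not> (\<exists>i\<in>I. H i = units)"
  then have proper: "\<exists>x\<in>units. x \<notin> H i" if "i \<in> I" for i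
    using that units by blast
  have small_H': "small (H i)" if "i \<in> I" for i
    using small_H[OF that] proper[OF that] subgroup_not_small[of "H i"] units mult inv that units_not_small
    by blast
  have power: "x ^ n \<in> H i" if "i \<in> I" "x \<in> H i" for i x n
    using that by (induction n) (auto intro: one mult)
  have finite_cover: "\<exists>i\<in>I. F \<subseteq> H i" if "finite F" "F \<subseteq> units" for F
    using that
  proof (induction F rule: finite_induct)
    case empty
    then show ?case using cover[of 1] by auto
  next
    case (insert x F)
    then obtain i j where "i \<in> I" "F \<subseteq> H i" "j \<in> I" "x \<in> H j"
      using cover[of x] by auto
    then show ?case using chain[of i j] by blast
  qed
  \<comment> \<open>Finitely many representatives lie in one member of the chain, and saturation
    adds their residue classes.\<close>
  have small_cover: "\<exists>i\<in>I. T \<inter> units \<subseteq> H i" if small: "small T" for T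
  proof -
    obtain F where F: "F \<subseteq> T \<inter> units" "finite F" "residue_class ` (T \<inter> units) = residue_class ` F"
      using finite_subset_image[OF small[unfolded small_def] subset_refl] by metis
    obtain i where i: "i \<in> I" "F \<subseteq> H i" using finite_cover[of F] F by auto
    have "x \<in> H i" if "x \<in> T \<inter> units" for x
    proof -
      have "residue_class x \<in> residue_class ` F" using that F(3) by blast
      then obtain y where "y \<in> F" "residue_eq y x"
        by (metis imageE residue_class_eq_iff)
      then show ?thesis using i saturated by blast
    qed
    then show ?thesis using i by blast
  qed
  have no_cosmall: "\<not> small (- S n)" if n: "n \<ge> 2" "of_nat n \<in> units" for n
  proof
    assume "small (- S n)"
    then obtain i where i: "i \<in> I" "- S n \<inter> units \<subseteq> H i" using small_cover by blast
    obtain \<zeta> where \<zeta>: "\<zeta> \<in> units" "\<zeta> ^ n = 1" "\<not> residue_eq \<zeta> 1"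
      using root_of_unity n by metis
    \<comment> \<open>\<open>H k\<close> contains the units outside \<open>S n\<close> and the root
      of unity. The group \<open>H j\<close> chosen next is strictly larger, and its elements
      outside \<open>H k\<close> have roots in \<open>H j\<close>.\<close>
    obtain k where k: "k \<in> I" "\<zeta> \<in> H k" "H i \<subseteq> H k"
      using i \<zeta> cover[of \<zeta>] chain by (metis subsetD subset_refl)
    obtain x0 where x0: "x0 \<in> units" "x0 \<notin> H k" using proper[OF k(1)] by blast
    obtain j where j: "j \<in> I" "x0 \<in> H j" using cover[OF x0(1)] by blast
    have kj: "H k \<subseteq> H j" using chain[OF k(1) j(1)] x0 j by blast
    have root: "\<exists>y\<in>H j. residue_eq (y ^ n) x" if x: "x \<in> H j" "x \<notin> H k" for x
    proof -
      have "x \<in> S n" using x i k units[OF j(1)] by blast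
      then show ?thesis unfolding S_def using x j(1) by blast
    qed
    have "\<exists>y\<in>H j. \<zeta> * y \<in> H j \<and> residue_eq (y ^ n) t" if t: "t \<in> H j" for t
    proof -
      have "\<exists>y\<in>H j. residue_eq (y ^ n) t"
      proof (cases "t \<in> H k")
        case True
        text \<open>Write \<open>t\<close> as the quotient of the elements \<open>x0 * t\<close> and \<open>x0\<close> outside of \<open>H k\<close>.\<close>
        have "x0 * t \<notin> H k"
        proof
          assume "x0 * t \<in> H k"
          then have "x0 * t * inverse t \<in> H k" using mult inv k(1) True by blast
          then show False using x0 units_nonzero[of t] units[OF k(1)] True by (auto simp: mult.assoc)
        qed
        then obtain y where y: "y \<in> H j" "residue_eq (y ^ n) (x0 * t)"
          using root[of "x0 * t"] mult[OF j(1) j(2) t] by blast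
        obtain z where z: "z \<in> H j" "residue_eq (z ^ n) x0"
          using root[of x0] j x0 by blast
        have zu: "z \<in> units" "y \<in> units" using z y units[OF j(1)] by auto
        have "residue_eq (y ^ n * inverse (z ^ n)) (x0 * t * inverse x0)"
          using y z zu
          by (intro residue_eq_mult residue_eq_inverse units_power units_inverse)
        moreover have "x0 * t * inverse x0 = t" using units_nonzero[OF x0(1)] by simp
        ultimately have "residue_eq ((y * inverse z) ^ n) t"
          by (simp add: power_mult_distrib power_inverse)
        then show ?thesis using mult inv j(1) y(1) z(1) by blast
      qed (use root t in blast)
      then show ?thesis using mult[OF j(1)] k(2) kj by blast
    qed
    then show False
      using no_small_root_closed[of "H j" \<zeta> n] small_H'[OF j(1)] units[OF j(1)] j \<zeta> by auto
  qed
  obtain m n a b :: nat where mn: "m \<ge> 2" "n \<ge> 2" "of_nat m \<in> units" "of_nat n \<in> units"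
    "m * a = n * b + 1"
    by (rule coprime_unit_exponents)
  have "small (S m \<union> S n)" using no_cosmall small_S mn by (intro small_Un) blast+
  then obtain i where i: "i \<in> I" "(S m \<union> S n) \<inter> units \<subseteq> H i" using small_cover by blast
  obtain x where x: "x \<in> units" "x \<notin> H i" using proper[OF i(1)] by blast
  text \<open>Both powers of \<open>x\<close> lie in a group of the chain avoiding \<open>x\<close>, as \<open>x\<close> is a root of them.\<close>
  have lower: "\<exists>j\<in>I. x ^ l \<in> H j \<and> x \<notin> H j" if "l \<in> {m, n}" for l
  proof (cases "x ^ l \<in> H i")
    case False
    then have "x ^ l \<notin> S l" using i that units_power[OF x(1), of l] by blast
    then show ?thesis unfolding S_def using x(1) units_power[OF x(1), of l] by auto
  qed (use i x in blast)
  obtain j k where jk: "j \<in> I" "x ^ m \<in> H j" "x \<notin> H j" "k \<in> I" "x ^ n \<in> H k" "x \<notin> H k"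
    using lower[of m] lower[of n] by blast
  \<comment> \<open>The larger of \<open>H j\<close> and \<open>H k\<close> contains both powers and
    still avoids \<open>x\<close>.\<close>
  then obtain l where l: "l \<in> I" "x ^ m \<in> H l" "x ^ n \<in> H l" "x \<notin> H l"
    using chain[of j k] by blast
  \<comment> \<open>As \<open>m * a = n * b + 1\<close>, this quotient is \<open>x\<close>
    itself.\<close>
  have "(x ^ m) ^ a * inverse ((x ^ n) ^ b) \<in> H l" using l power mult inv by blast
  moreover have "(x ^ m) ^ a = (x ^ n) ^ b * x"
    by (simp add: power_mult[symmetric] mn(5))
  moreover have "(x ^ n) ^ b * x * inverse ((x ^ n) ^ b) = x" using units_nonzero[OF x(1)] by simp
  ultimately show False using l by simp
qed

text \<open>The function \<open>g\<close> enters definable sets only through its graph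
  \<open>F\<close>. The bound at infinity may still depend on \<open>u\<close>;
  \<open>factorization_near_infinity\<close> makes it uniform.\<close>

lemma scaling_by_unit_eventually:
  assumes F: "dform L M (\<lambda>e. F (e 0) (e 1))"
    and F_iff: "\<And>x y. F x y \<longleftrightarrow> x \<in> Z \<and> y = g x"
    and Z: "eventually (\<lambda>x. x \<in> Z) at_inf"
    and u: "u \<in> units"
  shows "eventually (\<lambda>x. v (g (u * x)) = v (g x)) at_inf"
proof -
  note dF = dform_rel2[OF F _ _ dom_M]
  define lt where "lt u \<longleftrightarrow> eventually (\<lambda>x. v (g x) < v (g (u * x))) at_inf" for u
  \<comment> \<open>Agrees with the comparison in \<open>lt\<close> when both points lie in
    \<open>Z\<close>, but is definable.\<close>
  define Q where "Q u x \<longleftrightarrow> (\<exists>y. \<exists>y'. F x y \<and> F (u * x) y' \<and> v y < v y')" for u x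
  have Q_iff: "Q u x \<longleftrightarrow> x \<in> Z \<and> u * x \<in> Z \<and> v (g x) < v (g (u * x))" for u x
    by (auto simp: Q_def F_iff)
  have Z': "eventually (\<lambda>x. x \<in> Z \<and> u * x \<in> Z) at_inf" if "u \<noteq> 0" for u
    using eventually_conj[OF Z eventually_at_inf_scale[OF Z that]] .
  have lt_iff: "lt u \<longleftrightarrow> eventually (Q u) at_inf" if "u \<noteq> 0" for u
  proof
    assume "lt u"
    then show "eventually (Q u) at_inf"
      using Z'[OF that] unfolding lt_def by eventually_elim (simp add: Q_iff)
  next
    assume "eventually (Q u) at_inf"
    then show "lt u" unfolding lt_def by eventually_elim (simp add: Q_iff)
  qed
  have dichotomy: "eventually (\<lambda>x. v (g (u * x)) \<le> v (g x)) at_inf" if "u \<noteq> 0" "\<not> lt u" for u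
  proof -
    have "dform L M (\<lambda>e. Q u (e 0))"
      unfolding Q_def by (intro dform_intros dF)
    then have "eventually (\<lambda>x. \<not> Q u x) at_inf"
      using dform_dichotomy(2) that lt_iff by blast
    then show ?thesis using Z'[OF that(1)] by eventually_elim (simp add: Q_iff)
  qed
  \<comment> \<open>The positive cone, with \<open>lt\<close> spelled out in first-order form so
    that it is definable.\<close>
  define P where "P = {u. u \<noteq> 0 \<and> (\<exists>c. c \<noteq> 0 \<and> (\<forall>x. v x < v c \<longrightarrow> Q u x))}"
  have P_iff: "u \<in> P \<longleftrightarrow> u \<noteq> 0 \<and> lt u" for u
    by (auto simp: P_def lt_iff eventually_at_inf_iff_element)
  have not_lt_inverse: "\<not> lt (inverse u)" if "u \<noteq> 0" "lt u" for u
  proof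
    assume "lt (inverse u)"
    then have "eventually (\<lambda>x. v (g (u * x)) < v (g (inverse u * (u * x)))) at_inf"
      unfolding lt_def using that(1) by (rule eventually_at_inf_scale)
    moreover have "eventually (\<lambda>x. v (g x) < v (g (u * x))) at_inf"
      using that(2) by (simp add: lt_def)
    ultimately have "eventually (\<lambda>x. False) at_inf"
      by eventually_elim (use that(1) in \<open>auto simp: mult.assoc[symmetric]\<close>)
    then show False using at_inf_neq_bot by (simp add: eventually_False)
  qed
  \<comment> \<open>Without \<open>lt y\<close>, scaling by \<open>y\<close> eventually never
    increases the value, and neither does scaling \<open>n\<close> times.\<close>
  have root: "lt y" if "y \<noteq> 0" "lt (y ^ n)" for y n
  proof (rule ccontr)
    assume "\<not> lt y"
    note le = dichotomy[OF that(1) this]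
    have "eventually (\<lambda>x. v (g (y ^ k * x)) \<le> v (g x)) at_inf" for k
    proof (induction k)
      case (Suc k)
      have "eventually (\<lambda>x. v (g (y * (y ^ k * x))) \<le> v (g (y ^ k * x))) at_inf"
        using eventually_at_inf_scale[OF le, of "y ^ k"] that(1) by simp
      with Suc show ?case by eventually_elim (auto simp: mult.assoc)
    qed simp
    from this[of n] have "eventually (\<lambda>x. False) at_inf"
      using that(2) unfolding lt_def by eventually_elim auto
    then show False using at_inf_neq_bot by (simp add: eventually_False)
  qed
  have "dform L M (\<lambda>e. e 0 \<in> P)"
    unfolding P_def Q_def mem_Collect_eq by (intro dform_intros dF)
  then have "small P \<or> small (- P)"
    using dform_dichotomy(1)[of "\<lambda>x. x \<in> P"] by (simp add: Collect_neg_eq)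
  then have "small (P \<inter> units)"
  proof
    \<comment> \<open>Inversion maps the units of the cone into its complement, so a small
      complement makes them small as well.\<close>
    assume "small (- P)"
    then have "small (inverse ` (- P \<inter> units))"
      by (intro small_image) (auto intro: units_inverse residue_eq_inverse)
    moreover have "P \<inter> units \<subseteq> inverse ` (- P \<inter> units)"
    proof
      fix u assume u: "u \<in> P \<inter> units"
      then have "inverse u \<in> - P \<inter> units" using not_lt_inverse units_inverse by (auto simp: P_iff)
      then show "u \<in> inverse ` (- P \<inter> units)" by (intro image_eqI[of _ _ "inverse u"]) auto
    qed
    ultimately show ?thesis using small_mono by blast
  qed (auto elim: small_mono)
  then have "P \<inter> units = {}"
  proof (rule root_closed_empty)
    fix y :: 'a and n :: nat assume n: "n > 0" "y ^ n \<in> P \<inter> units"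
    then have "y \<in> units" using units_root by blast
    then show "y \<in> P \<inter> units" using n root units_nonzero by (auto simp: P_iff)
  qed simp
  then have not_lt: "\<not> lt u" if "u \<in> units" for u
    using that units_nonzero[OF that] P_iff by blast
  have "eventually (\<lambda>x. v (g (u * x)) \<le> v (g x)) at_inf"
    using dichotomy not_lt u units_nonzero by blast
  moreover have "eventually (\<lambda>x. v (g (inverse u * x)) \<le> v (g x)) at_inf"
    using dichotomy not_lt units_inverse[OF u] units_nonzero by blast
  \<comment> \<open>The estimate for the inverse of \<open>u\<close>, read at \<open>u * x\<close>,
    is the reverse inequality.\<close>
  from eventually_at_inf_scale[OF this units_nonzero[OF u]]
  have "eventually (\<lambda>x. v (g x) \<le> v (g (u * x))) at_inf"
    using units_nonzero[OF u] by (simp add: mult.assoc[symmetric])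
  ultimately show ?thesis by eventually_elim auto
qed

text \<open>Points of equal finite value differ by a unit factor, so one bound valid for all units
  is needed. The units good for a given bound, up to congruence, form the chain of
  subgroups.\<close>

lemma factorization_near_infinity:
  assumes F: "dform L M (\<lambda>e. F (e 0) (e 1))"
    and F_iff: "\<And>x y. F x y \<longleftrightarrow> x \<in> Z \<and> y = g x"
    and Z: "eventually (\<lambda>x. x \<in> Z) at_inf"
  obtains \<gamma> where "\<And>x x'. v x < Fin \<gamma> \<Longrightarrow> v x' = v x \<Longrightarrow> v (g x') = v (g x)"
proof -
  note dF = dform_rel2[OF F _ _ dom_M]
  obtain c0 where c0: "c0 \<noteq> 0" "\<And>x. v x < v c0 \<Longrightarrow> x \<in> Z"
    using Z by (auto simp: eventually_at_inf_iff_element)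
  define G where "G u c \<longleftrightarrow> u \<in> units \<and>
    (\<forall>x. v x < v c \<longrightarrow> (\<exists>y. \<exists>y'. F x y \<and> F (u * x) y' \<and> v y' = v y))" for u c
  \<comment> \<open>The saturation of \<open>G\<close> under congruence, since the chain lemma
    requires unions of residue classes.\<close>
  define H where "H u c \<longleftrightarrow> (\<exists>w. G w c \<and> residue_eq w u)" for u c
  \<comment> \<open>For these bounds all points compared lie in \<open>Z\<close>, so that
    \<open>F\<close> can be replaced by \<open>g\<close>.\<close>
  define I where "I = {c. c \<noteq> 0 \<and> v c \<le> v c0}"
  have G_iff: "G u c \<longleftrightarrow> u \<in> units \<and> (\<forall>x. v x < v c \<longrightarrow> v (g (u * x)) = v (g x))"
    if "c \<in> I" for u c
    using that c0(2) unfolding G_def F_iff I_def by (auto intro: order_less_le_trans)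
  have dG: "dform L M (\<lambda>e. G (t e) (s e))" if "dterm L M t" "dterm L M s" for t s
    by (rule dform_rel2[OF _ that dom_M]) (unfold G_def, intro dform_intros dF)
  have dH: "dform L M (\<lambda>e. H (t e) (s e))" if "dterm L M t" "dterm L M s" for t s
    by (rule dform_rel2[OF _ that dom_M]) (unfold H_def, intro dform_intros dG)
  have dG_mult: "G (u * w) c" if "c \<in> I" "G u c" "G w c" for u w c
    using that by (auto simp: G_iff mult.assoc intro: units_mult)
  have dG_inverse: "G (inverse u) c" if c: "c \<in> I" and u: "G u c" for u c
  proof -
    have unit: "u \<in> units" using u c by (simp add: G_iff)
    have "v (g (inverse u * x)) = v (g x)" if "v x < v c" for x
    proof -
      have "v (inverse u * x) < v c" using that units_inverse[OF unit] by simp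
      then have "v (g (u * (inverse u * x))) = v (g (inverse u * x))" using u c by (simp add: G_iff)
      then show ?thesis using units_nonzero[OF unit] by (simp add: mult.assoc[symmetric])
    qed
    then show ?thesis using c unit units_inverse by (simp add: G_iff)
  qed
  have mono: "G u c'" if "c \<in> I" "c' \<in> I" "v c' \<le> v c" "G u c" for u c c'
    using that by (auto simp: G_iff)
  have "\<exists>c\<in>I. {u. H u c} = units"
  proof (rule chain_of_unit_subgroups)
    show "{u. H u c} \<subseteq> units" if "c \<in> I" for c
      using that residue_eq_units by (auto simp: H_def G_iff)
    show "x * y \<in> {u. H u c}" if c: "c \<in> I" and xy: "x \<in> {u. H u c}" "y \<in> {u. H u c}" for c x y
    proof -
      obtain w w' where w: "G w c" "residue_eq w x" "G w' c" "residue_eq w' y"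
        using xy by (auto simp: H_def)
      then have "residue_eq (w * w') (x * y)"
        using c by (intro residue_eq_mult) (auto simp: G_iff)
      then show ?thesis using dG_mult[OF c] w by (auto simp: H_def)
    qed
    show "inverse x \<in> {u. H u c}" if c: "c \<in> I" and x: "x \<in> {u. H u c}" for c x
    proof -
      obtain w where w: "G w c" "residue_eq w x"
        using x by (auto simp: H_def)
      then have "residue_eq (inverse w) (inverse x)"
        using c by (intro residue_eq_inverse) (auto simp: G_iff)
      then show ?thesis using dG_inverse[OF c] w by (auto simp: H_def)
    qed
    show "1 \<in> {u. H u c}" if "c \<in> I" for c
      using that by (auto simp: H_def G_iff intro!: exI[of _ 1])
    show "y \<in> {u. H u c}" if "c \<in> I" "x \<in> {u. H u c}" "residue_eq x y" for c x y
      using that residue_eq_trans by (auto simp: H_def)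
    show "{u. H u c} \<subseteq> {u. H u c'} \<or> {u. H u c'} \<subseteq> {u. H u c}" if "c \<in> I" "c' \<in> I" for c c'
      using that mono linear[of "v c" "v c'"] unfolding H_def by blast
    show "\<exists>c\<in>I. x \<in> {u. H u c}" if x: "x \<in> units" for x
    proof -
      obtain c where c: "c \<noteq> 0" "\<And>y. v y < v c \<Longrightarrow> v (g (x * y)) = v (g y)"
        using scaling_by_unit_eventually[OF F F_iff Z x]
        by (auto simp: eventually_at_inf_iff_element)
      define c' where "c' = (if v c \<le> v c0 then c else c0)"
      have "c' \<in> I" "v c' \<le> v c" using c(1) c0(1) by (auto simp: c'_def I_def)
      then have "G x c'" using c x by (simp add: G_iff)
      then show ?thesis using \<open>c' \<in> I\<close> by (auto simp: H_def intro!: bexI[of _ c'] exI[of _ x])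
    qed
    show "small {u. H u c} \<or> small (- {u. H u c})" for c
      unfolding Collect_neg_eq[symmetric] by (intro dform_dichotomy(1) dH dterm_var dterm_const)
    show "small {x \<in> units. \<exists>y\<in>units. residue_eq (y ^ n) x \<and>
          \<not> (\<exists>c\<in>I. x \<in> {u. H u c} \<and> y \<notin> {u. H u c})} \<or>
        small (- {x \<in> units. \<exists>y\<in>units. residue_eq (y ^ n) x \<and>
          \<not> (\<exists>c\<in>I. x \<in> {u. H u c} \<and> y \<notin> {u. H u c})})" for n
      unfolding Collect_neg_eq[symmetric] Bex_def I_def mem_Collect_eq
      by (intro dform_dichotomy(1) dform_intros dH)
  qed
  then obtain c where c: "c \<in> I" "{u. H u c} = units" by blast
  \<comment> \<open>So far \<open>G\<close> is only known to meet every residue class of units.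
    Hence it is not small, so its complement is, and such a subgroup consists of all units.\<close>
  have "small {u. G u c} \<or> small {u. \<not> G u c}"
    by (intro dform_dichotomy(1) dG dterm_var dterm_const)
  moreover have "\<not> small {u. G u c}"
  proof
    assume small: "small {u. G u c}"
    have "residue_class u \<in> residue_class ` ({u. G u c} \<inter> units)" if "u \<in> units" for u
    proof -
      have "H u c" using that c(2) by blast
      then obtain w where "G w c" "residue_eq w u" by (auto simp: H_def)
      then show ?thesis using c(1)
        by (intro image_eqI[of _ _ w]) (auto simp: residue_class_eq_iff G_iff intro: residue_eq_sym)
    qed
    then have "residue_class ` (units \<inter> units) \<subseteq> residue_class ` ({u. G u c} \<inter> units)" by blast
    then have "small units" using small unfolding small_def by (rule finite_subset)
    then show False using units_not_small by simp
  qed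
  ultimately have "small (- {u. G u c})" by (simp add: Collect_neg_eq)
  then have G: "{u. G u c} = units"
    using dG_mult[OF c(1)] dG_inverse[OF c(1)] c(1) units_not_small
    by (intro subgroup_not_small) (auto simp: G_iff)
  obtain \<gamma> where \<gamma>: "v c = Fin \<gamma>" using c(1) v_nonzero by (auto simp: I_def)
  show ?thesis
  proof (rule that)
    fix x x' assume x: "v x < Fin \<gamma>" "v x' = v x"
    then have x0: "x \<noteq> 0" by auto
    have "v (x * (x' / x)) \<le> v (x * 1)" "v (x * 1) \<le> v (x * (x' / x))" using x x0 by simp_all
    then have "x' / x \<in> units" unfolding v_mult_le_iff[OF x0] by (simp add: units_def)
    then have "G (x' / x) c" using G by blast
    then show "v (g x') = v (g x)" using x x0 \<gamma> c(1) by (auto simp: G_iff)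
  qed
qed

end


section \<open>Families\<close>

lemma map_upt_add: "map e [0..<n + k] = map e [0..<n] @ map (\<lambda>i. e (n + i)) [0..<k]"
  by (rule nth_equalityI) (auto simp: nth_append)

text \<open>The entries from \<open>n\<close> on represent group coordinates through their values; a
  zero entry has value \<open>Pinf\<close> and is excluded by \<open>map Fin gs\<close>.\<close>

lemma definable2_iff_dform:
  assumes dom: "dom M = UNIV"
  shows "definable2 L M v n m D \<longleftrightarrow> (\<forall>(xs, gs) \<in> D. length xs = n \<and> length gs = m) \<and>
    dform L M (\<lambda>e. \<exists>gs. map (\<lambda>i. v (e (n + i))) [0..<m] = map Fin gs \<and> (map e [0..<n], gs) \<in> D)"
proof (cases "\<forall>(xs, gs) \<in> D. length xs = n \<and> length gs = m")
  case True
  define B where "B = {xs @ ys |xs ys gs. (xs, gs) \<in> D \<and> map v ys = map Fin gs}"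
  have len: "length xs = n \<and> length ys = m" if "(xs, gs) \<in> D" "map v ys = map Fin gs" for xs ys gs
    using True that map_eq_imp_length_eq[OF that(2)] by auto
  have mem: "map e [0..<n + m] \<in> B \<longleftrightarrow>
      (\<exists>gs. map (\<lambda>i. v (e (n + i))) [0..<m] = map Fin gs \<and> (map e [0..<n], gs) \<in> D)" for e
  proof
    assume "map e [0..<n + m] \<in> B"
    then obtain xs ys gs where *: "map e [0..<n] @ map (\<lambda>i. e (n + i)) [0..<m] = xs @ ys"
      "(xs, gs) \<in> D" "map v ys = map Fin gs"
      unfolding B_def map_upt_add by blast
    then have xs: "xs = map e [0..<n]" and ys: "ys = map (\<lambda>i. e (n + i)) [0..<m]"
      using len[OF *(2,3)] by (auto simp: append_eq_append_conv)
    have "map (\<lambda>i. v (e (n + i))) [0..<m] = map v ys" unfolding ys by simp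
    then show "\<exists>gs. map (\<lambda>i. v (e (n + i))) [0..<m] = map Fin gs \<and> (map e [0..<n], gs) \<in> D"
      using *(2,3) unfolding xs by auto
  next
    assume "\<exists>gs. map (\<lambda>i. v (e (n + i))) [0..<m] = map Fin gs \<and> (map e [0..<n], gs) \<in> D"
    then obtain gs where "map v (map (\<lambda>i. e (n + i)) [0..<m]) = map Fin gs"
      "(map e [0..<n], gs) \<in> D"
      by (auto simp: comp_def)
    then show "map e [0..<n + m] \<in> B" unfolding B_def map_upt_add by blast
  qed
  have "\<forall>xs\<in>B. length xs = n + m" using len by (auto simp: B_def)
  then have "definable L M (n + m) B \<longleftrightarrow> dform L M (\<lambda>e. map e [0..<n + m] \<in> B)"
    by (simp add: definable_iff_dform[OF dom])
  then show ?thesis using True unfolding definable2_def B_def[symmetric] mem by simp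
qed (unfold definable2_def, blast)

theorem theorem3p7:
  fixes L :: "('f, 'r) vf_language"
    and M :: "('f, 'r, 'a::alg_closed_field) fo_struct"
    and v :: "'a \<Rightarrow> 'g::linordered_ab_group_add extended"
    and n m :: nat
    and W :: "('a list \<times> 'g list) set"
    and X :: "(('a list \<times> 'g list) \<times> 'a) set"
    and f :: "'a list \<times> 'g list \<Rightarrow> 'a \<Rightarrow> 'a"
  assumes "C_minimal_valued_field L M v"
    and "definable2 L M v n m W"
    and "definable_field_fun_family L M v n m W X f"
    and "\<forall>(w, x) \<in> X. f w x \<noteq> 0"
    and "family_defined_near_infinity v W X"
  shows "\<exists>Y h. definable_group_fun_family L M v n m W Y h \<and>
           (\<forall>w\<in>W. factorizes_at_infinity v (X `` {w}) (f w) (Y `` {w}) (h w))"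
proof -
  interpret C_minimal_vf L M v by unfold_locales (rule assms(1))
  have W: "fst ` X = W" using assms(3)
    by (simp add: definable_field_fun_family_def definable_field_family_def)
  have len: "length xs = n \<and> length gs = m" if "(xs, gs) \<in> W" for xs gs
    using assms(2) that unfolding definable2_def by blast
  have X_W: "w \<in> W" if "(w, x) \<in> X" for w x
    using that unfolding W[symmetric] by force
  define R where "R xs ws x y \<longleftrightarrow>
    (\<exists>gs. ws = map Fin gs \<and> ((xs, gs), x) \<in> X \<and> y = f (xs, gs) x)" for xs ws x y
  have R_iff: "R xs (map Fin gs) x y \<longleftrightarrow> ((xs, gs), x) \<in> X \<and> y = f (xs, gs) x" for xs gs x y
  proof -
    have "inj (Fin :: 'g \<Rightarrow> 'g extended)" by (simp add: inj_def)
    then show ?thesis unfolding R_def by (auto simp: inj_map_eq_map)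
  qed
  have dR: "dform L M (\<lambda>e. R (map (\<lambda>l. assign s e l) [0..<n])
      (map (\<lambda>l. v (assign s e (n + l))) [0..<m]) (e i) (e j))" for s i j
  proof -
    \<comment> \<open>In a tuple of the graph, the point and its image stand at positions
      \<open>n\<close> and \<open>n + 1\<close>, between the field and the group parameters; hence
      \<open>k - 2\<close> beyond them.\<close>
    define s' where "s' k = (if k < n then s k else if k = n then Inl i
      else if k = Suc n then Inl j else s (k - 2))" for k
    let ?G = "{(xs @ [x, f (xs, gs) x], gs) |xs gs x. ((xs, gs), x) \<in> X}"
    have "dform L M (\<lambda>e. \<exists>gs. map (\<lambda>i. v (e (n + 2 + i))) [0..<m] = map Fin gs \<and>
        (map e [0..<n + 2], gs) \<in> ?G)"
      using assms(3) by (simp add: definable_field_fun_family_def definable2_iff_dform[OF dom_M])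
    from dform_subst[OF this, of s']
    have *: "dform L M (\<lambda>e. \<exists>gs. map (\<lambda>i. v (assign s' e (n + 2 + i))) [0..<m] = map Fin gs \<and>
        (map (assign s' e) [0..<n + 2], gs) \<in> ?G)" .
    have e1: "assign s' e (n + 2 + l) = assign s e (n + l)" for e l
      by (simp add: assign_def s'_def)
    have e2: "map (assign s' e) [0..<n + 2] = map (\<lambda>l. assign s e l) [0..<n] @ [e i, e j]" for e
      by (auto simp: map_upt_add numeral_2_eq_2 assign_def s'_def)
    have "(xs @ [x, y], gs) \<in> ?G \<longleftrightarrow> ((xs, gs), x) \<in> X \<and> y = f (xs, gs) x" for xs x y gs
      by auto
    then show ?thesis using * unfolding e1 e2 R_def by simp
  qed
  \<comment> \<open>The first conjunct demands a point of value \<open>\<gamma>\<close>, which makes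
    \<open>\<delta>\<close> unique and the choice of \<open>h\<close> sound.\<close>
  define \<Psi> where "\<Psi> w \<gamma> \<delta> \<longleftrightarrow> (\<exists>x. (w, x) \<in> X \<and> v x = Fin \<gamma>) \<and>
    (\<forall>x. (w, x) \<in> X \<longrightarrow> v x = Fin \<gamma> \<longrightarrow> v (f w x) = Fin \<delta>)" for w \<gamma> \<delta>
  define Y where "Y = {(w, \<gamma>). \<exists>\<delta>. \<Psi> w \<gamma> \<delta>}"
  define h where "h w \<gamma> = (THE \<delta>. \<Psi> w \<gamma> \<delta>)" for w \<gamma>
  have \<Psi>_unique: "\<delta> = \<delta>'" if "\<Psi> w \<gamma> \<delta>" "\<Psi> w \<gamma> \<delta>'" for w \<gamma> \<delta> \<delta>'
    using that unfolding \<Psi>_def by force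
  have h: "h w \<gamma> = \<delta>" if "\<Psi> w \<gamma> \<delta>" for w \<gamma> \<delta>
    unfolding h_def using that \<Psi>_unique by (intro the_equality) auto
  have graph: "(w, \<gamma>) \<in> Y \<and> \<delta> = h w \<gamma> \<longleftrightarrow> \<Psi> w \<gamma> \<delta>" for w \<gamma> \<delta>
    unfolding Y_def mem_Collect_eq case_prod_conv using h by metis
  have Y_W: "w \<in> W" if "(w, \<gamma>) \<in> Y" for w \<gamma>
    using that X_W unfolding Y_def \<Psi>_def mem_Collect_eq case_prod_conv by blast
  have near_infinity: "\<exists>\<gamma>0. \<forall>x x'. v x < Fin \<gamma>0 \<longrightarrow>
      (w, x) \<in> X \<and> (v x' = v x \<longrightarrow> v (f w x') = v (f w x))" if w: "w \<in> W" for w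
  proof -
    obtain xs gs where xs: "w = (xs, gs)" by fastforce
    \<comment> \<open>Field elements representing the group parameters make \<open>f w\<close>
      definable with parameters in the field.\<close>
    have "\<exists>ys. map v ys = map Fin gs" for gs :: "'g list"
    proof (induction gs)
      case (Cons g gs)
      then obtain ys where "map v ys = map Fin gs" by blast
      moreover obtain y where "v y = Fin g" using v_surj by blast
      ultimately have "map v (y # ys) = map Fin (g # gs)" by simp
      then show ?case by blast
    qed simp
    then obtain ys where ys: "map v ys = map Fin gs" by blast
    have lens: "length xs = n" "length ys = m"
      using len w xs map_eq_imp_length_eq[OF ys] by auto
    define s where "s l = (Inr (if l < n then xs ! l else ys ! (l - n)) :: nat + 'a)" for l
    have "map (\<lambda>l. assign s e l) [0..<n] = xs" for e
      by (rule nth_equalityI) (simp_all add: lens assign_def s_def)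
    moreover have "map (\<lambda>l. v (assign s e (n + l))) [0..<m] = map v ys" for e
      by (rule nth_equalityI) (simp_all add: lens assign_def s_def)
    ultimately have F: "dform L M (\<lambda>e. R xs (map Fin gs) (e 0) (e 1))"
      using dR[of s 0 1] by (simp add: ys)
    have F_iff: "R xs (map Fin gs) x y \<longleftrightarrow> x \<in> X `` {w} \<and> y = f w x" for x y
      by (simp add: R_iff xs)
    obtain \<gamma>1 where \<gamma>1: "- closed_ball v 0 (Fin \<gamma>1) \<subseteq> X `` {w}"
      using assms(5) w unfolding family_defined_near_infinity_def nbhd_infinity_def by blast
    have Z: "x \<in> X `` {w}" if "v x < Fin \<gamma>1" for x
      using subsetD[OF \<gamma>1, of x] that by (simp add: closed_ball_def not_le)
    then have "eventually (\<lambda>x. x \<in> X `` {w}) at_inf"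
      unfolding eventually_at_inf by blast
    from factorization_near_infinity[OF F F_iff this] obtain \<gamma>2 where
      \<gamma>2: "\<And>x x'. v x < Fin \<gamma>2 \<Longrightarrow> v x' = v x \<Longrightarrow> v (f w x') = v (f w x)" by metis
    have "v x < Fin \<gamma>1 \<and> v x < Fin \<gamma>2" if "v x < Fin (min \<gamma>1 \<gamma>2)" for x
      using that by (cases "v x") auto
    then show ?thesis using Z \<gamma>2 by (intro exI[of _ "min \<gamma>1 \<gamma>2"]) blast
  qed
  have \<Psi>_near: "\<exists>\<gamma>0. \<forall>x. v x < Fin \<gamma>0 \<longrightarrow> (\<exists>\<gamma> \<delta>. v x = Fin \<gamma> \<and> v (f w x) = Fin \<delta> \<and> \<Psi> w \<gamma> \<delta>)"
    if w: "w \<in> W" for w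
  proof -
    obtain \<gamma>0 where \<gamma>0: "\<forall>x x'. v x < Fin \<gamma>0 \<longrightarrow>
        (w, x) \<in> X \<and> (v x' = v x \<longrightarrow> v (f w x') = v (f w x))"
      using near_infinity[OF w] by blast
    have "\<exists>\<gamma> \<delta>. v x = Fin \<gamma> \<and> v (f w x) = Fin \<delta> \<and> \<Psi> w \<gamma> \<delta>" if x: "v x < Fin \<gamma>0" for x
    proof -
      have "x \<noteq> 0" using x by auto
      then obtain \<gamma> where \<gamma>: "v x = Fin \<gamma>" using v_nonzero by blast
      \<comment> \<open>Here the values of \<open>f\<close> being nonzero makes
        \<open>v (f w x)\<close> an element of the group.\<close>
      have "f w x \<noteq> 0" using assms(4) \<gamma>0 x by blast
      then obtain \<delta> where \<delta>: "v (f w x) = Fin \<delta>" using v_nonzero by blast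
      have "v (f w x') = Fin \<delta>" if "v x' = Fin \<gamma>" for x'
        using \<gamma>0 x that unfolding \<gamma>[symmetric] \<delta>[symmetric] by blast
      then have "\<Psi> w \<gamma> \<delta>" using \<gamma> \<gamma>0 x unfolding \<Psi>_def by blast
      then show ?thesis using \<gamma> \<delta> by blast
    qed
    then show ?thesis by blast
  qed
  have fst_Y: "fst ` Y = W"
  proof
    show "fst ` Y \<subseteq> W" using Y_W by auto
    show "W \<subseteq> fst ` Y"
    proof
      fix w assume "w \<in> W"
      then obtain \<gamma>0 where \<gamma>0: "\<forall>x. v x < Fin \<gamma>0 \<longrightarrow>
          (\<exists>\<gamma> \<delta>. v x = Fin \<gamma> \<and> v (f w x) = Fin \<delta> \<and> \<Psi> w \<gamma> \<delta>)"
        using \<Psi>_near by blast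
      obtain x where "v x < Fin \<gamma>0" using v_below by blast
      then obtain \<gamma> \<delta> where "\<Psi> w \<gamma> \<delta>" using \<gamma>0 by blast
      then have "(w, \<gamma>) \<in> Y" by (auto simp: Y_def)
      then show "w \<in> fst ` Y" by force
    qed
  qed
  \<comment> \<open>The relation \<open>\<Psi>\<close> in terms of field elements \<open>c\<close>
    and \<open>d\<close> of values \<open>\<gamma>\<close> and \<open>\<delta>\<close>, since
    formulas quantify over the field only.\<close>
  define \<Theta> where "\<Theta> e c d \<longleftrightarrow> c \<noteq> 0 \<and> d \<noteq> 0 \<and>
    (\<exists>x. \<exists>y. R (map (\<lambda>l. e l) [0..<n]) (map (\<lambda>l. v (e (n + l))) [0..<m]) x y \<and> v x = v c) \<and>
    (\<forall>x. \<forall>y. R (map (\<lambda>l. e l) [0..<n]) (map (\<lambda>l. v (e (n + l))) [0..<m]) x y \<and> v x = v c \<longrightarrow>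
      v y = v d)" for e :: "nat \<Rightarrow> 'a" and c d
  have \<Theta>_\<Psi>: "\<Theta> e c d \<longleftrightarrow> \<Psi> (map e [0..<n], gs) \<gamma> \<delta>"
    if "map (\<lambda>l. v (e (n + l))) [0..<m] = map Fin gs" "v c = Fin \<gamma>" "v d = Fin \<delta>" for e c d gs \<gamma> \<delta>
  proof -
    have "c \<noteq> 0" "d \<noteq> 0" using that(2,3) by auto
    then show ?thesis unfolding \<Theta>_def \<Psi>_def that R_iff by blast
  qed
  have \<Theta>_iff: "\<Theta> e c d \<longleftrightarrow> (\<exists>gs \<gamma> \<delta>. map (\<lambda>l. v (e (n + l))) [0..<m] = map Fin gs \<and>
      v c = Fin \<gamma> \<and> v d = Fin \<delta> \<and> \<Psi> (map e [0..<n], gs) \<gamma> \<delta>)" (is "_ \<longleftrightarrow> ?rhs") for e c d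
  proof
    assume \<Theta>: "\<Theta> e c d"
    then have "c \<noteq> 0" "d \<noteq> 0" unfolding \<Theta>_def by blast+
    then obtain \<gamma> \<delta> where "v c = Fin \<gamma>" "v d = Fin \<delta>" using v_nonzero by metis
    moreover obtain gs where "map (\<lambda>l. v (e (n + l))) [0..<m] = map Fin gs"
      using \<Theta> unfolding \<Theta>_def R_def by blast
    ultimately show ?rhs using \<Theta> \<Theta>_\<Psi> by blast
  next
    assume ?rhs
    then show "\<Theta> e c d" using \<Theta>_\<Psi> by blast
  qed
  have dR': "dform L M (\<lambda>e. R (map (\<lambda>l. e (\<sigma> l)) [0..<n])
      (map (\<lambda>l. v (e (\<sigma> (n + l)))) [0..<m]) (e i) (e j))" for \<sigma> i j
    using dR[of "\<lambda>l. Inl (\<sigma> l)" i j] by (simp add: assign_def)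
  have Y_iff: "(\<exists>d. \<Theta> e (e (n + m)) d) \<longleftrightarrow>
      (\<exists>gs. map (\<lambda>i. v (e (n + i))) [0..<Suc m] = map Fin gs \<and>
        (map e [0..<n], gs) \<in> {(xs, gs @ [\<gamma>]) |xs gs \<gamma>. ((xs, gs), \<gamma>) \<in> Y})" for e
  proof -
    have "\<exists>d. v d = Fin \<delta>" for \<delta> using v_surj by blast
    then have "(\<exists>d. \<Theta> e (e (n + m)) d) \<longleftrightarrow>
        (\<exists>gs \<gamma>. map (\<lambda>l. v (e (n + l))) [0..<m] = map Fin gs \<and>
          v (e (n + m)) = Fin \<gamma> \<and> ((map e [0..<n], gs), \<gamma>) \<in> Y)"
      unfolding \<Theta>_iff Y_def mem_Collect_eq case_prod_conv by blast
    also have "\<dots> \<longleftrightarrow> (\<exists>gs \<gamma>. map (\<lambda>i. v (e (n + i))) [0..<Suc m] = map Fin (gs @ [\<gamma>]) \<and>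
        ((map e [0..<n], gs), \<gamma>) \<in> Y)"
      by simp
    finally show ?thesis by blast
  qed
  \<comment> \<open>The parameters stand under the quantifiers over \<open>d\<close>,
    \<open>x\<close> and \<open>y\<close>, whence a shift by three.\<close>
  have "dform L M (\<lambda>e. \<exists>d. \<Theta> e (e (n + m)) d)"
    by (rule dform_Ex[OF _ dom_M])
      (unfold \<Theta>_def, intro dform_intros dR'[of "\<lambda>l. Suc (Suc (Suc l))"])
  then have Y_definable: "definable2 L M v n (Suc m) {(xs, gs @ [\<gamma>]) |xs gs \<gamma>. ((xs, gs), \<gamma>) \<in> Y}"
    unfolding definable2_iff_dform[OF dom_M] Y_iff using len Y_W by fastforce
  have h_iff: "\<Theta> e (e (n + m)) (e (n + Suc m)) \<longleftrightarrow>
      (\<exists>gs. map (\<lambda>i. v (e (n + i))) [0..<Suc (Suc m)] = map Fin gs \<and>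
        (map e [0..<n], gs) \<in> {(xs, gs @ [\<gamma>, h (xs, gs) \<gamma>]) |xs gs \<gamma>. ((xs, gs), \<gamma>) \<in> Y})" for e
  proof -
    have "\<Theta> e (e (n + m)) (e (n + Suc m)) \<longleftrightarrow>
        (\<exists>gs \<gamma> \<delta>. map (\<lambda>i. v (e (n + i))) [0..<Suc (Suc m)] = map Fin (gs @ [\<gamma>, \<delta>]) \<and>
          ((map e [0..<n], gs), \<gamma>) \<in> Y \<and> \<delta> = h (map e [0..<n], gs) \<gamma>)"
      unfolding \<Theta>_iff graph by simp
    then show ?thesis by blast
  qed
  \<comment> \<open>Now \<open>d\<close> is an entry of the environment, so the shift is only by
    two.\<close>
  have "dform L M (\<lambda>e. \<Theta> e (e (n + m)) (e (n + Suc m)))"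
    unfolding \<Theta>_def by (intro dform_intros dR'[of "\<lambda>l. Suc (Suc l)"])
  then have "definable2 L M v n (Suc (Suc m))
      {(xs, gs @ [\<gamma>, h (xs, gs) \<gamma>]) |xs gs \<gamma>. ((xs, gs), \<gamma>) \<in> Y}"
    unfolding definable2_iff_dform[OF dom_M] h_iff using len Y_W by fastforce
  then have "definable_group_fun_family L M v n m W Y h"
    using fst_Y Y_definable by (simp add: definable_group_fun_family_def definable_group_family_def)
  moreover have "factorizes_at_infinity v (X `` {w}) (f w) (Y `` {w}) (h w)" if "w \<in> W" for w
  proof -
    obtain \<gamma>0 where \<gamma>0: "\<forall>x. v x < Fin \<gamma>0 \<longrightarrow>
        (\<exists>\<gamma> \<delta>. v x = Fin \<gamma> \<and> v (f w x) = Fin \<delta> \<and> \<Psi> w \<gamma> \<delta>)"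
      using \<Psi>_near \<open>w \<in> W\<close> by blast
    have "\<exists>\<gamma>\<in>Y `` {w}. v x = Fin \<gamma> \<and> v (f w x) = Fin (h w \<gamma>)"
      if x: "x \<in> X `` {w} - closed_ball v 0 (Fin \<gamma>0)" for x
    proof -
      have "v x < Fin \<gamma>0" using x by (auto simp: closed_ball_def)
      then obtain \<gamma> \<delta> where "v x = Fin \<gamma>" "v (f w x) = Fin \<delta>" "\<Psi> w \<gamma> \<delta>" using \<gamma>0 by blast
      then show ?thesis using graph[of w \<gamma> \<delta>] by (intro bexI[of _ \<gamma>]) auto
    qed
    then show ?thesis unfolding factorizes_at_infinity_def by blast
  qed
  ultimately show ?thesis by blast
qed

end
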